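(* Let $G$ be a $BCP$-group satisfying $2,3\in\pi(G)$ and suppose that $u_2=1$ and $u_3\in\{1,2\}$. Then $G$ is a locally finite group.
   Context: For a periodic group $G$, $\pi(G)$ denotes the set of all primes dividing the order of some element of $G$. A group $G$ is called a $BCP$-group if each element of $G$ has (finite) prime power order (the identity, of order $1$, is allowed) and for each $p\in\pi(G)$ there exists a positive integer $u_p$ such that each $p$-element of $G$ (element whose order is a power of $p$) has order $p^i\leq p^{u_p}$. The numbers $u_2,u_3$ in the claim are these bounds for $p=2,3$; that is, $u_2=1$ means each $2$-element of $G$ has order at most $2$, and $u_3\in\{1,2\}$ means each $3$-element of $G$ has order at most $3^{u_3}$ with $u_3$ equal to $1$ or $2$. A group is locally finite if each of its finitely generated subgroups is finite. *)

theory Defs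
  imports
    "HOL-Algebra.Multiplicative_Group"
    "HOL-Algebra.Generated_Groups"
    "HOL-Computational_Algebra.Primes"
begin

(* group.ord G x is 0 exactly when x has infinite order; as every number divides 0,
   elements of infinite order have to be excluded explicitly. *)
definition prime_spectrum :: "('a, 'b) monoid_scheme \<Rightarrow> nat set" where
  "prime_spectrum G =
     {p. prime p \<and> (\<exists>x \<in> carrier G. group.ord G x \<noteq> 0 \<and> p dvd group.ord G x)}"

definition p_element :: "('a, 'b) monoid_scheme \<Rightarrow> nat \<Rightarrow> 'a \<Rightarrow> bool" where
  "p_element G p x \<longleftrightarrow> x \<in> carrier G \<and> (\<exists>k::nat. group.ord G x = p ^ k)"

definition p_order_bound :: "('a, 'b) monoid_scheme \<Rightarrow> nat \<Rightarrow> nat \<Rightarrow> bool" where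
  "p_order_bound G p u \<longleftrightarrow> 0 < u \<and> (\<forall>x. p_element G p x \<longrightarrow> group.ord G x \<le> p ^ u)"

(* A prime power is nonzero, so the second conjunct makes the group periodic;
   the identity is covered by the exponent 0. *)
definition BCP_group :: "('a, 'b) monoid_scheme \<Rightarrow> bool" where
  "BCP_group G \<longleftrightarrow>
     group G \<and>
     (\<forall>x \<in> carrier G. \<exists>p k. prime p \<and> group.ord G x = p ^ k) \<and>
     (\<forall>p \<in> prime_spectrum G. \<exists>u. p_order_bound G p u)"

definition finitely_generated_subgroup :: "'a set \<Rightarrow> ('a, 'b) monoid_scheme \<Rightarrow> bool" where
  "finitely_generated_subgroup H G \<longleftrightarrow>
     subgroup H G \<and> (\<exists>S. finite S \<and> S \<subseteq> carrier G \<and> H = generate G S)"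

definition locally_finite_group :: "('a, 'b) monoid_scheme \<Rightarrow> bool" where
  "locally_finite_group G \<longleftrightarrow>
     group G \<and> (\<forall>H. finitely_generated_subgroup H G \<longrightarrow> finite H)"

end

theory Submission
  imports Defs "HOL-Algebra.Polynomial_Divisibility"
begin

text \<open>
  The hypothesis on \<open>2\<close>-elements says that an element of \<open>G\<close> is either an involution (or the
  identity) or has odd order. Hence an element commuting with an involution has square
  \<open>\<one>\<close>: the centralizer of an involution is an elementary abelian \<open>2\<close>-group, two such
  centralizers coincide or meet trivially, and two involutions that do not commute have a
  product of odd order and are conjugate in the dihedral group that they generate. The basic tool
  is \<open>cent_mult_involution\<close>: if \<open>x\<close> does not normalize the centralizer \<open>S\<close> of an involution, then
  \<open>x = c s\<close> with \<open>c \<in> S\<close> and an involution \<open>s\<close>. It replaces, in this possibly infinite group,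
  the counting of involutions in finite group theory. There are three cases.

  If all involutions commute, they form together with \<open>\<one>\<close> a normal elementary abelian
  \<open>2\<close>-group \<open>N\<close>, on which \<open>G/N\<close> acts without fixed points. The point is that \<open>G/N\<close> has only one
  subgroup of order three (\<open>order_three_unique\<close>). Elements \<open>a\<close>, \<open>b\<close> of order three satisfy
  \<open>a\<^sup>2 + a + 1 = 0 = b\<^sup>2 + b + 1\<close> on \<open>N\<close>, so they generate a quaternion-like algebra of characteristic
  two. There \<open>u = ab + ba\<close> inverts both \<open>a\<close> and \<open>b\<close>. Since square roots of elements of odd
  order exist, some \<open>f = a b r\<close> in the group commutes with \<open>u\<close>, while a trace computation shows that
  only \<open>f = 1\<close> is possible; this makes \<open>a\<close> and \<open>b\<close> commute modulo \<open>N\<close>, and commuting elements of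
  order three acting freely generate the same subgroup. A unique subgroup of order three is
  central here, so \<open>G/N\<close> is a \<open>3\<close>-group by the prime power condition. Its exponent divides \<open>9\<close>, and
  commutator computations bound its order (\<open>unique_order_three.finite_carrier\<close>). Thus \<open>G\<close> has an
  abelian torsion subgroup of finite index.

  If some involution \<open>t\<close> centralizes only \<open>\<one>\<close> and \<open>t\<close>, and not all involutions commute, then the
  elements that are not involutions form an abelian subgroup of index two, inverted by \<open>t\<close>.

  In the remaining case \<open>G\<close> is finite. As in the groups \<open>SL\<^sub>2(2\<^sup>n)\<close>, it acts on the set of
  centralizers of involutions; the stabilizer of the point \<open>S\<close> is a product \<open>S D\<close>, where the
  two-point stabilizer \<open>D\<close> is inverted by an involution, hence abelian, and permutes
  the nonidentity elements of \<open>S\<close> regularly. So \<open>S\<close> carries the structure of a field with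
  multiplicative group \<open>D\<close>. By the prime power condition \<open>D\<close> is a \<open>p\<close>-group for a single prime
  \<open>p\<close>, of bounded exponent, and a field has only finitely many roots of unity of a given
  exponent: \<open>S\<close> and \<open>D\<close> are finite (\<open>cent_finite_if_torus_exponent\<close>). Finally \<open>S\<close> is transitive on
  the other points, so there are finitely many involutions and \<open>G\<close> is finite
  (\<open>finite_carrier_if_finite_cent\<close>).
\<close>

section \<open>Powers, conjugation and elements of order two\<close>

context group
begin

lemma l_inv_cancel: "\<lbrakk>x \<in> carrier G; y \<in> carrier G\<rbrakk> \<Longrightarrow> inv x \<otimes> (x \<otimes> y) = y"
  by (simp add: m_assoc [symmetric])

lemma r_inv_cancel: "\<lbrakk>x \<in> carrier G; y \<in> carrier G\<rbrakk> \<Longrightarrow> x \<otimes> (inv x \<otimes> y) = y"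
  by (simp add: m_assoc [symmetric])

lemmas word_simps = m_assoc inv_mult_group l_inv_cancel r_inv_cancel

lemma intertwine_pow:
  assumes "g \<in> carrier G" "x \<in> carrier G" "y \<in> carrier G" "g \<otimes> x = y \<otimes> g"
  shows "g \<otimes> x [^] (k::nat) = y [^] k \<otimes> g"
proof (induction k)
  case (Suc k)
  have "g \<otimes> x [^] Suc k = (g \<otimes> x [^] k) \<otimes> x"
    using assms by (simp add: m_assoc)
  also have "\<dots> = y [^] k \<otimes> (g \<otimes> x)"
    using assms Suc by (simp add: m_assoc)
  also have "\<dots> = y [^] Suc k \<otimes> g"
    using assms by (simp add: m_assoc)
  finally show ?case .
qed (use assms in simp)

text \<open>
  The root is a power of the element itself. Hence it is inverted, or centralized, by
  whatever inverts or centralizes the element.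
\<close>

lemma odd_square_root:
  assumes "x \<in> carrier G" "x [^] (m::nat) = \<one>" "odd m"
  obtains k :: nat where "x [^] k \<otimes> x [^] k = x"
proof -
  obtain k where "m = 2 * k + 1" using assms(3) by (auto elim: oddE)
  hence "x [^] Suc k \<otimes> x [^] Suc k = x [^] (m + 1)"
    using assms(1) by (simp only: nat_pow_mult) (simp add: mult_2)
  also have "\<dots> = x" using assms by (simp flip: nat_pow_mult)
  finally show thesis using that by blast
qed

lemma one_of_coprime_pow:
  assumes "x \<in> carrier G" "x [^] (m::nat) = \<one>" "x [^] (n::nat) = \<one>" "coprime m n"
  shows "x = \<one>"
proof -
  have "ord x dvd m" "ord x dvd n" using assms pow_eq_id by auto
  hence "ord x = 1" using assms(4) by (metis coprime_common_divisor_nat)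
  thus ?thesis using assms(1) ord_eq_1 by blast
qed

lemma involution_inv: "\<lbrakk>t \<in> carrier G; t \<otimes> t = \<one>\<rbrakk> \<Longrightarrow> inv t = t"
  by (simp add: inv_equality)

lemma involution_cancel: "\<lbrakk>t \<in> carrier G; t \<otimes> t = \<one>; x \<in> carrier G\<rbrakk> \<Longrightarrow> t \<otimes> (t \<otimes> x) = x"
  by (simp add: m_assoc [symmetric])

lemma commute_if_square_one:
  assumes "x \<in> carrier G" "y \<in> carrier G" "x \<otimes> x = \<one>" "y \<otimes> y = \<one>"
    "(x \<otimes> y) \<otimes> (x \<otimes> y) = \<one>"
  shows "x \<otimes> y = y \<otimes> x"
proof -
  have "inv (x \<otimes> y) = x \<otimes> y" using assms by (intro involution_inv) auto
  thus ?thesis using assms by (metis inv_mult_group involution_inv)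
qed

lemma conj_eq_iff:
  assumes "g \<in> carrier G" "x \<in> carrier G"  "y \<in> carrier G"
  shows "g \<otimes> x \<otimes> inv g = y \<longleftrightarrow> g \<otimes> x = y \<otimes> g"
  using assms by (metis inv_closed inv_solve_right m_closed)

end

text \<open>
  If \<open>p \<noteq> q\<close>, the prime \<open>r\<close> differs from one of them, and then the
  corresponding factor is killed by two coprime exponents.
\<close>

lemma (in group) commuting_prime_power_same_prime:
  assumes xy: "x \<in> carrier G" "y \<in> carrier G" "x \<otimes> y = y \<otimes> x" "x \<noteq> \<one>" "y \<noteq> \<one>"
    and p: "Factorial_Ring.prime (p::nat)" "x [^] (p ^ k) = \<one>"
    and q: "Factorial_Ring.prime (q::nat)" "y [^] (q ^ j) = \<one>"
    and r: "Factorial_Ring.prime (r::nat)" "(x \<otimes> y) [^] (r ^ l) = \<one>"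
  shows "p = q"
proof (rule ccontr)
  assume "p \<noteq> q"
  have one: "x = \<one>" if xy: "x \<in> carrier G" "y \<in> carrier G" "x \<otimes> y = y \<otimes> x"
    and p: "Factorial_Ring.prime p" "x [^] (p ^ k) = \<one>" and q: "Factorial_Ring.prime q" "y [^] (q ^ j) = \<one>"
    and r: "(x \<otimes> y) [^] (r ^ l) = \<one>" and ne: "p \<noteq> q" "r \<noteq> p" for x y and p q k j :: nat
  proof -
    have "(x \<otimes> y) [^] (r ^ l * q ^ j) = \<one>" using xy(1,2) r by (simp flip: nat_pow_pow)
    hence "x [^] (r ^ l * q ^ j) \<otimes> y [^] (q ^ j * r ^ l) = \<one>"
      using pow_mult_distrib[OF xy(3,1,2)] by (simp add: mult.commute)
    hence "x [^] (r ^ l * q ^ j) = \<one>" using xy(1,2) q(2) by (simp flip: nat_pow_pow[of y])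
    moreover have "coprime (r ^ l * q ^ j) (p ^ k)"
      using primes_coprime[OF \<open>Factorial_Ring.prime r\<close> p(1)] primes_coprime[OF q(1) p(1)] ne by simp
    ultimately show ?thesis using one_of_coprime_pow xy(1) p(2) by blast
  qed
  have "r = p" using one[OF xy(1-3) p q r(2) \<open>p \<noteq> q\<close>] xy by blast
  moreover have "r = q"
    using one[OF xy(2,1) xy(3)[symmetric] q p _ \<open>p \<noteq> q\<close>[symmetric]] r(2) xy by metis
  ultimately show False using \<open>p \<noteq> q\<close> by simp
qed

section \<open>Virtually abelian torsion groups are locally finite\<close>

text \<open>
  Submonoids suffice, and save the verification of closure under inverses: in a torsion
  group they are subgroups.
\<close>

lemma (in group) finite_submonoid_in_abelian_torsion:
  assumes comm: "\<And>x y. \<lbrakk>x \<in> N; y \<in> N\<rbrakk> \<Longrightarrow> x \<otimes> y = y \<otimes> x"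
    and torsion: "\<And>x. x \<in> N \<Longrightarrow> \<exists>n>0::nat. x [^] n = \<one>"
    and sub: "subgroup N G"
    and E: "finite E" "E \<subseteq> N"
  shows "\<exists>M. finite M \<and> E \<subseteq> M \<and> M \<subseteq> N \<and> \<one> \<in> M \<and> (\<forall>x\<in>M. \<forall>y\<in>M. x \<otimes> y \<in> M)"
  using E
proof (induction E rule: finite_induct)
  case empty
  show ?case by (rule exI[of _ "{\<one>}"]) (use sub subgroup.one_closed in auto)
next
  case (insert e E)
  obtain M where M: "finite M" "E \<subseteq> M" "M \<subseteq> N" "\<one> \<in> M" "\<And>x y. x \<in> M \<Longrightarrow> y \<in> M \<Longrightarrow> x \<otimes> y \<in> M"
    using insert.IH insert.prems by blast
  note N = subgroup.subset[OF sub]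
  have e: "e \<in> N" "e \<in> carrier G" using insert.prems N by auto
  obtain n :: nat where n: "n > 0" "e [^] n = \<one>" using torsion e by blast
  define M' where "M' = {e [^] i \<otimes> m |i m. i < n \<and> m \<in> M}"
  have red: "e [^] (i::nat) \<otimes> m \<in> M'" if "m \<in> M" for i m
  proof -
    have "e [^] i = e [^] (n * (i div n) + i mod n)" by simp
    also have "\<dots> = (e [^] n) [^] (i div n) \<otimes> e [^] (i mod n)"
      using e by (simp only: nat_pow_mult nat_pow_pow)
    also have "\<dots> = e [^] (i mod n)" using n e by simp
    finally show ?thesis using that n unfolding M'_def
      by (intro CollectI exI[of _ "i mod n"] exI[of _ m]) auto
  qed
  have powN: "e [^] (i::nat) \<in> N" for i
    using e sub by (induction i) (auto simp: subgroup.one_closed subgroup.m_closed)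
  have "x \<otimes> y \<in> M'" if xy: "x \<in> M'" "y \<in> M'" for x y
  proof -
    obtain i m j k where x: "x = e [^] (i::nat) \<otimes> m" "m \<in> M" and y: "y = e [^] (j::nat) \<otimes> k" "k \<in> M"
      using xy by (auto simp: M'_def)
    have c: "m \<in> carrier G" "k \<in> carrier G" "m \<in> N" using x y M N by auto
    have "x \<otimes> y = e [^] i \<otimes> (m \<otimes> e [^] j) \<otimes> k" using x y c e by (simp add: m_assoc)
    also have "m \<otimes> e [^] j = e [^] j \<otimes> m" using comm c powN by blast
    finally have "x \<otimes> y = e [^] (i + j) \<otimes> (m \<otimes> k)" using c e by (simp add: m_assoc flip: nat_pow_mult)
    thus ?thesis using red M(5) x y by auto
  qed
  moreover have "finite M'"
  proof -
    have "M' = (\<lambda>(i, m). e [^] i \<otimes> m) ` ({..<n} \<times> M)" by (auto simp: M'_def)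
    thus ?thesis using M by simp
  qed
  moreover have "insert e E \<subseteq> M'" "\<one> \<in> M'"
  proof -
    have "x \<in> M'" if "x \<in> M" for x using red[OF that, of 0] that M N by auto
    moreover have "e \<in> M'" using red[OF M(4), of 1] e by simp
    ultimately show "insert e E \<subseteq> M'" "\<one> \<in> M'" using M by auto
  qed
  moreover have "M' \<subseteq> N" using powN M(3) sub by (auto simp: M'_def subgroup.m_closed subset_iff)
  ultimately show ?case by (intro exI[of _ M']) blast
qed

text \<open>
  Fix representatives of the finitely many cosets. The finitely many factors in \<open>N\<close> by which
  products of representatives and generators deviate from representatives have finitely many
  conjugates, because \<open>N\<close> is abelian. These conjugates generate a finite normal
  subgroup \<open>P\<close>, and the products of a representative with an element of \<open>P\<close> form a finite
  submonoid \<open>Q\<close> that contains the generators and their inverses.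
\<close>

lemma (in group) finite_generate_if_virtually_abelian_torsion:
  assumes sub: "subgroup N G"
    and normal: "\<And>x g. \<lbrakk>x \<in> N; g \<in> carrier G\<rbrakk> \<Longrightarrow> g \<otimes> x \<otimes> inv g \<in> N"
    and comm: "\<And>x y. \<lbrakk>x \<in> N; y \<in> N\<rbrakk> \<Longrightarrow> x \<otimes> y = y \<otimes> x"
    and torsion: "\<And>x. x \<in> N \<Longrightarrow> \<exists>n>0::nat. x [^] n = \<one>"
    and T: "finite T" "T \<subseteq> carrier G" "\<And>g. g \<in> carrier G \<Longrightarrow> \<exists>t\<in>T. inv t \<otimes> g \<in> N"
    and B: "finite B" "B \<subseteq> carrier G"
  shows "finite (generate G B)"
proof -
  interpret N: subgroup N G by fact
  obtain \<rho> where \<rho>: "\<And>g. g \<in> carrier G \<Longrightarrow> \<rho> g \<in> T" "\<And>g. g \<in> carrier G \<Longrightarrow> inv (\<rho> g) \<otimes> g \<in> N"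
    using T(3) by metis
  define U where "U = {\<one>} \<union> B \<union> m_inv G ` B \<union> (\<lambda>(t, t'). t \<otimes> t') ` (T \<times> T)"
  have U: "finite U" "U \<subseteq> carrier G" using B T by (auto simp: U_def)
  define E where "E = (\<lambda>g. inv (\<rho> g) \<otimes> g) ` U"
  define E' where "E' = {g \<otimes> e \<otimes> inv g |g e. g \<in> carrier G \<and> e \<in> E}"
  have E: "E \<subseteq> N" using \<rho> U by (auto simp: E_def)
  have "E' \<subseteq> (\<lambda>(t, e). t \<otimes> e \<otimes> inv t) ` (T \<times> E)"
  proof
    fix x assume "x \<in> E'"
    then obtain g e where ge: "x = g \<otimes> e \<otimes> inv g" "g \<in> carrier G" "e \<in> E" by (auto simp: E'_def)
    obtain t where t: "t \<in> T" "inv t \<otimes> g \<in> N" using T(3) ge by blast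
    define n where "n = inv t \<otimes> g"
    have c: "t \<in> carrier G" "e \<in> N" "e \<in> carrier G" using t T E ge by auto
    have g: "g = t \<otimes> n" using ge c by (simp add: n_def r_inv_cancel)
    have n: "n \<in> N" "n \<in> carrier G" using t by (auto simp: n_def)
    have "n \<otimes> e \<otimes> inv n = e" using comm[OF n(1) c(2)] n c by (subst conj_eq_iff) auto
    moreover have "x = t \<otimes> (n \<otimes> e \<otimes> inv n) \<otimes> inv t"
      using ge c n by (simp add: g word_simps)
    ultimately show "x \<in> (\<lambda>(t, e). t \<otimes> e \<otimes> inv t) ` (T \<times> E)" using t ge by auto
  qed
  moreover have "finite E" using U by (simp add: E_def)
  ultimately have finE': "finite E'" using T finite_subset by blast
  have E': "E' \<subseteq> N" using E normal by (auto simp: E'_def)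
  have EE': "E \<subseteq> E'"
  proof
    fix e assume "e \<in> E"
    hence "e = \<one> \<otimes> e \<otimes> inv \<one>" using E by auto
    thus "e \<in> E'" using \<open>e \<in> E\<close> unfolding E'_def by blast
  qed
  obtain M where M: "finite M" "E' \<subseteq> M" "M \<subseteq> N" "\<one> \<in> M" "\<And>x y. x \<in> M \<Longrightarrow> y \<in> M \<Longrightarrow> x \<otimes> y \<in> M"
    using finite_submonoid_in_abelian_torsion[OF comm torsion sub finE' E'] by blast
  \<comment> \<open>The smallest such submonoid: unlike an arbitrary one it is invariant under conjugation.\<close>
  define P where "P = \<Inter>{M. E' \<subseteq> M \<and> M \<subseteq> N \<and> \<one> \<in> M \<and> (\<forall>x\<in>M. \<forall>y\<in>M. x \<otimes> y \<in> M)}"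
  have P: "P \<subseteq> M" "E' \<subseteq> P" "\<one> \<in> P" "\<And>x y. x \<in> P \<Longrightarrow> y \<in> P \<Longrightarrow> x \<otimes> y \<in> P" "P \<subseteq> N"
    using M by (auto simp: P_def)
  have Pconj: "g \<otimes> x \<otimes> inv g \<in> P" if g: "g \<in> carrier G" and x: "x \<in> P" for g x
  proof -
    define M2 where "M2 = {x \<in> N. g \<otimes> x \<otimes> inv g \<in> P}"
    have "E' \<subseteq> M2"
    proof
      fix y assume "y \<in> E'"
      then obtain h e where h: "y = h \<otimes> e \<otimes> inv h" "h \<in> carrier G" "e \<in> E" by (auto simp: E'_def)
      have "g \<otimes> y \<otimes> inv g = (g \<otimes> h) \<otimes> e \<otimes> inv (g \<otimes> h)" using g h E by (auto simp: word_simps)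
      hence "g \<otimes> y \<otimes> inv g \<in> E'" using g h E unfolding E'_def by blast
      thus "y \<in> M2" using P E' \<open>y \<in> E'\<close> by (auto simp: M2_def)
    qed
    moreover have "x \<otimes> y \<in> M2" if "x \<in> M2" "y \<in> M2" for x y
    proof -
      have "g \<otimes> (x \<otimes> y) \<otimes> inv g = (g \<otimes> x \<otimes> inv g) \<otimes> (g \<otimes> y \<otimes> inv g)"
        using that g by (auto simp: M2_def word_simps)
      thus ?thesis using P(4) that by (auto simp: M2_def)
    qed
    moreover have "\<one> \<in> M2" using g P by (simp add: M2_def)
    ultimately have "P \<subseteq> M2" unfolding P_def by (intro Inter_lower) (auto simp: M2_def)
    thus ?thesis using x by (auto simp: M2_def)
  qed
  define Q where "Q = {t \<otimes> m |t m. t \<in> T \<and> m \<in> P}"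
  have UQ: "u \<in> Q" if "u \<in> U" for u
  proof -
    have "u \<in> carrier G" using U that by blast
    hence "\<rho> u \<otimes> (inv (\<rho> u) \<otimes> u) = u" using \<rho>(1)[of u] T(2) by (intro r_inv_cancel) auto
    hence "u = \<rho> u \<otimes> (inv (\<rho> u) \<otimes> u)" by simp
    moreover have "inv (\<rho> u) \<otimes> u \<in> P" using that EE' P by (auto simp: E_def)
    ultimately show ?thesis using \<rho>(1) \<open>u \<in> carrier G\<close> unfolding Q_def by blast
  qed
  have Qmult: "x \<otimes> y \<in> Q" if "x \<in> Q" "y \<in> Q" for x y
  proof -
    obtain t m t' m' where x: "x = t \<otimes> m" "t \<in> T" "m \<in> P" and y: "y = t' \<otimes> m'" "t' \<in> T" "m' \<in> P"
      using \<open>x \<in> Q\<close> \<open>y \<in> Q\<close> by (auto simp: Q_def)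
    have c: "t \<in> carrier G" "t' \<in> carrier G" "m \<in> carrier G" "m' \<in> carrier G"
      using x y T P(5) by auto
    have "t \<otimes> t' \<in> U" using x y by (auto simp: U_def)
    from UQ[OF this] obtain t2 m2 where t2: "t \<otimes> t' = t2 \<otimes> m2" "t2 \<in> T" "m2 \<in> P" by (auto simp: Q_def)
    have c2: "t2 \<in> carrier G" "m2 \<in> carrier G" using t2 T P(5) by auto
    define m3 where "m3 = inv t' \<otimes> m \<otimes> inv (inv t')"
    have m3: "m3 \<in> P" "m3 \<in> carrier G" using Pconj[of "inv t'" m] x c by (auto simp: m3_def)
    have "x \<otimes> y = (t \<otimes> t') \<otimes> m3 \<otimes> m'" using c by (simp add: x y m3_def word_simps)
    also have "\<dots> = t2 \<otimes> (m2 \<otimes> m3 \<otimes> m')" using c c2 m3 by (simp add: t2 m_assoc)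
    finally show ?thesis using t2 m3 y P(4) unfolding Q_def by blast
  qed
  have "generate G B \<subseteq> Q"
  proof
    fix x assume "x \<in> generate G B"
    thus "x \<in> Q" by induction (use UQ Qmult in \<open>auto simp: U_def\<close>)
  qed
  moreover have "finite Q"
  proof -
    have "Q = (\<lambda>(t, m). t \<otimes> m) ` (T \<times> P)" by (auto simp: Q_def)
    thus ?thesis using T finite_subset[OF P(1) M(1)] by simp
  qed
  ultimately show ?thesis using finite_subset by blast
qed

section \<open>Centralizers of involutions\<close>

definition (in group) cent :: "'a \<Rightarrow> 'a set" where
  "cent t = {x \<in> carrier G. t \<otimes> x = x \<otimes> t}"

definition (in group) involutions :: "'a set" where
  "involutions = {t \<in> carrier G. t \<noteq> \<one> \<and> t \<otimes> t = \<one>}"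

lemma (in group) subgroup_cent: "t \<in> carrier G \<Longrightarrow> subgroup (cent t) G"
proof (unfold_locales, goal_cases)
  case (4 x)
  hence *: "x \<in> carrier G" "t \<otimes> x = x \<otimes> t" "t \<in> carrier G" by (auto simp: cent_def)
  have "inv x \<otimes> (t \<otimes> x) \<otimes> inv x = inv x \<otimes> (x \<otimes> t) \<otimes> inv x" using * by simp
  hence "inv x \<otimes> t = t \<otimes> inv x" using *(1,3) by (simp add: word_simps)
  thus ?case using * by (simp add: cent_def)
next
  case (2 x y)
  hence *: "x \<in> carrier G" "t \<otimes> x = x \<otimes> t" "t \<in> carrier G" "y \<in> carrier G" "t \<otimes> y = y \<otimes> t" by (auto simp: cent_def)
  have "t \<otimes> (x \<otimes> y) = (t \<otimes> x) \<otimes> y" using *(1,3,4) by (simp add: m_assoc)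
  also have "\<dots> = x \<otimes> (t \<otimes> y)" unfolding *(2) using *(1,3,4) by (simp add: m_assoc)
  also have "\<dots> = (x \<otimes> y) \<otimes> t" unfolding *(5) using * by (simp add: m_assoc)
  finally show ?case using * by (simp add: cent_def)
qed (auto simp: cent_def)

locale square_one_or_odd = group +
  assumes dichotomy: "x \<in> carrier G \<Longrightarrow> x \<otimes> x = \<one> \<or> (\<exists>m::nat. odd m \<and> x [^] m = \<one>)"
begin

text \<open>
  Such an element would have order four otherwise, neither two nor odd.
\<close>

lemma square_one_if_fourth_power:
  assumes "x \<in> carrier G" "(x \<otimes> x) \<otimes> (x \<otimes> x) = \<one>"
  shows "x \<otimes> x = \<one>"
proof (rule ccontr)
  assume "x \<otimes> x \<noteq> \<one>"
  then obtain m :: nat where "odd m" "x [^] m = \<one>" using dichotomy assms(1) by blast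
  moreover have "x [^] (4::nat) = \<one>"
    using assms by (simp add: numeral_eq_Suc m_assoc)
  moreover have "coprime m 4"
    using \<open>odd m\<close> coprime_power_right_iff[of m 2 2] by simp
  ultimately have "x = \<one>" using one_of_coprime_pow assms by blast
  with \<open>x \<otimes> x \<noteq> \<one>\<close> show False by simp
qed

lemma involution_not_odd:
  assumes "t \<in> involutions" "odd (m::nat)" "t [^] m = \<one>"
  shows False
proof -
  have t: "t \<in> carrier G" "t \<noteq> \<one>" "t \<otimes> t = \<one>" using assms by (auto simp: involutions_def)
  hence "t [^] (2::nat) = \<one>" by (simp add: numeral_eq_Suc)
  thus False using one_of_coprime_pow[OF t(1) assms(3), of 2] assms(2) t(2) by simp
qed

text \<open>
  Otherwise \<open>x\<close> has odd order and \<open>t x\<close> has neither order two nor odd order.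
\<close>

lemma cent_square:
  assumes t: "t \<in> involutions" and x: "x \<in> cent t"
  shows "x \<otimes> x = \<one>"
proof (rule ccontr)
  assume "x \<otimes> x \<noteq> \<one>"
  have c: "t \<in> carrier G" "t \<otimes> t = \<one>" "x \<in> carrier G" "t \<otimes> x = x \<otimes> t"
    using t x by (auto simp: involutions_def cent_def)
  obtain m :: nat where m: "odd m" "x [^] m = \<one>" using dichotomy c \<open>x \<otimes> x \<noteq> \<one>\<close> by blast
  have "(t \<otimes> x) \<otimes> (t \<otimes> x) = (t \<otimes> t) \<otimes> (x \<otimes> x)" using c by (metis m_assoc m_closed)
  hence "(t \<otimes> x) \<otimes> (t \<otimes> x) \<noteq> \<one>" using c \<open>x \<otimes> x \<noteq> \<one>\<close> by simp
  then obtain n :: nat where n: "odd n" "(t \<otimes> x) [^] n = \<one>" using dichotomy c by blast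
  have "t [^] n \<otimes> x [^] n = \<one>" using pow_mult_distrib[OF c(4,1,3), of n] n by simp
  hence "(t [^] n \<otimes> x [^] n) [^] m = \<one>" by simp
  moreover have "(t [^] n \<otimes> x [^] n) [^] m = t [^] (n * m)"
  proof -
    have "(t [^] n \<otimes> x [^] n) [^] m = (t \<otimes> x) [^] (n * m)"
      using c(1,3) by (simp add: nat_pow_pow flip: pow_mult_distrib[OF c(4,1,3)])
    also have "\<dots> = t [^] (n * m) \<otimes> (x [^] m) [^] n"
      using pow_mult_distrib[OF c(4,1,3), of "n * m"] c(1,3) by (simp add: nat_pow_pow mult.commute)
    finally show ?thesis using m c by simp
  qed
  ultimately show False using involution_not_odd[OF t, of "n * m"] n m by simp
qed

lemma cent_commute:
  assumes t: "t \<in> involutions" and x: "x \<in> cent t" "y \<in> cent t"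
  shows "x \<otimes> y = y \<otimes> x"
proof -
  interpret C: subgroup "cent t" G using subgroup_cent t by (simp add: involutions_def)
  show ?thesis
    using assms cent_square[OF t] by (intro commute_if_square_one) auto
qed

text \<open>
  Commuting is transitive on involutions; the centralizers of involutions are therefore either
  equal or disjoint apart from \<open>\<one>\<close>.
\<close>

lemma cent_eq:
  assumes t: "t \<in> involutions" and x: "x \<in> cent t" "x \<noteq> \<one>"
  shows "x \<in> involutions" "cent x = cent t"
proof -
  show x': "x \<in> involutions" using x cent_square[OF t x(1)] by (simp add: involutions_def cent_def)
  have "t \<in> cent x" using t x by (simp add: cent_def involutions_def)
  show "cent x = cent t"
  proof (intro equalityI subsetI)
    fix y assume y: "y \<in> cent x"
    show "y \<in> cent t" using cent_commute[OF x' \<open>t \<in> cent x\<close> y] y by (simp add: cent_def)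
  next
    fix y assume y: "y \<in> cent t"
    show "y \<in> cent x" using cent_commute[OF t x(1) y] y by (simp add: cent_def)
  qed
qed

lemma involution_in_cent: "t \<in> involutions \<Longrightarrow> t \<in> cent t"
  by (auto simp: cent_def involutions_def)

lemma conj_involution:
  assumes "g \<in> carrier G" "t \<in> involutions"
  shows "g \<otimes> t \<otimes> inv g \<in> involutions"
proof -
  have t: "t \<in> carrier G" "t \<noteq> \<one>" "t \<otimes> t = \<one>" using assms by (auto simp: involutions_def)
  have "g \<otimes> t \<otimes> inv g \<noteq> \<one>" using t assms by (simp add: conj_eq_iff)
  thus ?thesis using t assms by (simp add: involutions_def word_simps involution_cancel)
qed

lemma conj_cent:
  assumes "g \<in> carrier G" "t \<in> carrier G" "x \<in> cent t"
  shows "g \<otimes> x \<otimes> inv g \<in> cent (g \<otimes> t \<otimes> inv g)"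
proof -
  have x: "x \<in> carrier G" "t \<otimes> x = x \<otimes> t" using assms by (auto simp: cent_def)
  have "g \<otimes> (t \<otimes> x) \<otimes> inv g = g \<otimes> (x \<otimes> t) \<otimes> inv g" using x by simp
  thus ?thesis using x(1) assms(1,2) by (simp add: cent_def word_simps)
qed

text \<open>strong reality decomposition\<close>

text \<open>
  The square root \<open>r\<close> of \<open>y\<close> is inverted by \<open>t\<close> as well, so \<open>t r\<close> is an involution.
\<close>

lemma inverted_by_involution_factor:
  assumes t: "t \<in> involutions" and y: "y \<in> carrier G" "t \<otimes> y = inv y \<otimes> t" "y \<otimes> y \<noteq> \<one>"
  obtains r where "r \<in> carrier G" "r \<otimes> r = y" "t \<otimes> r = inv r \<otimes> t" "t \<otimes> r \<in> involutions"
proof -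
  have tc: "t \<in> carrier G" "t \<otimes> t = \<one>" "t \<noteq> \<one>" using t by (auto simp: involutions_def)
  obtain m :: nat where m: "odd m" "y [^] m = \<one>" using dichotomy y by blast
  obtain k :: nat where k: "y [^] k \<otimes> y [^] k = y" using odd_square_root y(1) m by metis
  define r where "r = y [^] k"
  have r: "r \<in> carrier G" "r \<otimes> r = y" using k y by (auto simp: r_def)
  have trace: "t \<otimes> r = inv r \<otimes> t"
    using intertwine_pow[of t y "inv y" k] tc y by (simp add: r_def nat_pow_inv)
  have "t \<otimes> r \<noteq> \<one>"
  proof
    assume "t \<otimes> r = \<one>"
    hence "r = t" using tc r by (metis involution_inv inv_comm inv_equality)
    with r y tc show False by simp
  qed
  moreover have "(t \<otimes> r) \<otimes> (t \<otimes> r) = \<one>"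
  proof -
    have "(t \<otimes> r) \<otimes> (t \<otimes> r) = (t \<otimes> r) \<otimes> (inv r \<otimes> t)" by (simp only: trace[symmetric])
    also have "\<dots> = \<one>" using r tc by (simp add: word_simps)
    finally show ?thesis .
  qed
  ultimately have "t \<otimes> r \<in> involutions" using r tc by (simp add: involutions_def)
  with r trace that show thesis by blast
qed

text \<open>
  The commutator \<open>y\<close> of \<open>t\<close> and \<open>x\<close> is inverted by \<open>t\<close>. Unless the two conjugates of \<open>t\<close> commute, it
  has odd order; with a square root \<open>r\<close> of \<open>y\<close> the element \<open>x r\<^sup>-\<^sup>1\<close> centralizes \<open>t\<close>, and \<open>t r\<close> is an
  involution.
\<close>

lemma cent_mult_involution:
  assumes t: "t \<in> involutions" and x: "x \<in> carrier G" "x \<otimes> t \<otimes> inv x \<notin> cent t"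
  obtains c s where "c \<in> cent t" "s \<in> involutions" "x = c \<otimes> s"
proof -
  have tc: "t \<in> carrier G" "t \<otimes> t = \<one>" "inv t = t" using t by (auto simp: involutions_def involution_inv)
  define y where "y = t \<otimes> (inv x \<otimes> t \<otimes> x)"
  have y: "y \<in> carrier G" using tc x by (simp add: y_def)
  have ty: "t \<otimes> y = inv y \<otimes> t"
    using tc x by (simp add: y_def word_simps involution_cancel)
  have "y \<otimes> y \<noteq> \<one>"
  proof
    assume "y \<otimes> y = \<one>"
    hence "inv y = y" using y by (intro involution_inv)
    hence "t \<otimes> (inv x \<otimes> t \<otimes> x) = (inv x \<otimes> t \<otimes> x) \<otimes> t"
      using tc x by (simp add: y_def word_simps)
    hence "x \<otimes> (t \<otimes> (inv x \<otimes> t \<otimes> x)) \<otimes> inv x = x \<otimes> ((inv x \<otimes> t \<otimes> x) \<otimes> t) \<otimes> inv x" by simp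
    hence "t \<otimes> (x \<otimes> t \<otimes> inv x) = (x \<otimes> t \<otimes> inv x) \<otimes> t"
      using tc x(1) by (simp add: word_simps)
    with x tc show False by (simp add: cent_def)
  qed
  then obtain r where r: "r \<in> carrier G" "r \<otimes> r = y" "t \<otimes> r = inv r \<otimes> t" "t \<otimes> r \<in> involutions"
    using inverted_by_involution_factor[OF t y ty] by blast
  define c where "c = x \<otimes> inv r"
  have c: "c \<in> carrier G" "x = c \<otimes> r" using x r by (auto simp: c_def word_simps)
  have "c \<otimes> t = x \<otimes> (inv r \<otimes> t)" using tc x r by (simp add: c_def m_assoc)
  also have "\<dots> = x \<otimes> (t \<otimes> r)" using r by simp
  also have "\<dots> = x \<otimes> t \<otimes> y \<otimes> inv r"
    using tc x r(1) unfolding r(2)[symmetric] by (simp add: word_simps)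
  also have "\<dots> = t \<otimes> c"
    using tc x r(1) by (simp add: c_def y_def word_simps involution_cancel)
  finally have "c \<in> cent t" using c by (simp add: cent_def)
  moreover have "t \<in> cent t" using t by (rule involution_in_cent)
  ultimately have "c \<otimes> t \<in> cent t"
    using subgroup.m_closed[OF subgroup_cent] tc by blast
  moreover have "x = (c \<otimes> t) \<otimes> (t \<otimes> r)"
    using tc c r(1) by (simp add: word_simps involution_cancel)
  ultimately show thesis using that r by blast
qed

text \<open>
  In the dihedral group generated by \<open>t\<close> and \<open>s\<close>, whose rotation \<open>t s\<close> has odd order, a square root
  of the rotation carries one reflection to the other.
\<close>

lemma noncommuting_involutions_conjugate:
  assumes "t \<in> involutions" "s \<in> involutions" "s \<notin> cent t"
  obtains g where "g \<in> carrier G" "s = g \<otimes> t \<otimes> inv g"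
proof -
  have tc: "t \<in> carrier G" "t \<otimes> t = \<one>" "inv t = t" "s \<in> carrier G" "s \<otimes> s = \<one>" "inv s = s"
    using assms by (auto simp: involutions_def involution_inv)
  have "(t \<otimes> s) \<otimes> (t \<otimes> s) \<noteq> \<one>"
    using commute_if_square_one[of t s] tc assms(3) by (auto simp: cent_def)
  moreover have "t \<otimes> (t \<otimes> s) = inv (t \<otimes> s) \<otimes> t"
    using tc by (simp add: word_simps involution_cancel)
  ultimately obtain r where r: "r \<in> carrier G" "r \<otimes> r = t \<otimes> s" "t \<otimes> r = inv r \<otimes> t"
    using inverted_by_involution_factor[OF assms(1), of "t \<otimes> s"] tc by auto
  have "inv r \<otimes> t \<otimes> inv (inv r) = t \<otimes> (r \<otimes> r)"
    using r(1,3) tc by (simp add: m_assoc[symmetric])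
  also have "\<dots> = s" using tc by (simp add: r(2) involution_cancel)
  finally show thesis using that[of "inv r"] r by simp
qed

end

section \<open>An involution that centralizes only itself\<close>

lemma (in square_one_or_odd) torsion:
  assumes "x \<in> carrier G"
  shows "\<exists>n>0::nat. x [^] n = \<one>"
proof (cases "x \<otimes> x = \<one>")
  case True
  hence "x [^] (2::nat) = \<one>" using assms by (simp add: numeral_eq_Suc)
  thus ?thesis by (intro exI[of _ 2]) auto
next
  case False
  then obtain m :: nat where "odd m" "x [^] m = \<one>" using dichotomy assms by blast
  thus ?thesis by (intro exI[of _ m]) (auto simp: odd_pos)
qed

text \<open>
  By \<open>cent_mult_involution\<close> every element that is not an involution has the form \<open>t s\<close> with an
  involution \<open>s\<close>, hence is inverted by \<open>t\<close>. The product of two such elements is a product of two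
  involutions, which is not an involution because involutions commute only if they
  are equal. So these elements form a subgroup of index at most two, abelian because inversion is
  an automorphism.
\<close>

lemma (in square_one_or_odd) finite_generate_if_small_centralizer:
  assumes t: "t \<in> involutions" and small: "cent t \<subseteq> {\<one>, t}"
    and B: "finite B" "B \<subseteq> carrier G"
  shows "finite (generate G B)"
proof -
  define A where "A = carrier G - involutions"
  have tc: "t \<in> carrier G" "t \<otimes> t = \<one>" "inv t = t" using t by (auto simp: involutions_def involution_inv)
  have form: "\<exists>s \<in> involutions. x = t \<otimes> s" if x: "x \<in> A" for x
  proof (cases "x \<otimes> t \<otimes> inv x \<in> cent t")
    case True
    have xc: "x \<in> carrier G" using x by (simp add: A_def)
    have "x \<otimes> t \<otimes> inv x \<in> involutions" using conj_involution xc t by blast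
    hence "x \<otimes> t \<otimes> inv x = t" using True small by (auto simp: involutions_def)
    hence "x \<in> cent t" using xc tc by (simp add: cent_def conj_eq_iff)
    hence "x = \<one>" using small x t by (auto simp: A_def)
    thus ?thesis using t tc by (intro bexI[of _ t]) auto
  next
    case False
    have xc: "x \<in> carrier G" using x by (simp add: A_def)
    then obtain c s where cs: "c \<in> cent t" "s \<in> involutions" "x = c \<otimes> s"
      using cent_mult_involution[OF t] False by blast
    have "c = t" using cs x small by (auto simp: A_def involutions_def)
    thus ?thesis using cs by blast
  qed
  have form': "t \<otimes> s \<in> A" if s: "s \<in> involutions" for s
  proof (rule ccontr)
    assume "t \<otimes> s \<notin> A"
    have sc: "s \<in> carrier G" "s \<otimes> s = \<one>" "s \<noteq> \<one>" using s by (auto simp: involutions_def)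
    hence "(t \<otimes> s) \<otimes> (t \<otimes> s) = \<one>" "t \<otimes> s \<noteq> \<one>" using tc \<open>t \<otimes> s \<notin> A\<close> by (auto simp: A_def involutions_def)
    moreover from this have "s \<in> cent t"
      using commute_if_square_one[of t s] sc(1,2) tc(1,2) by (simp add: cent_def)
    ultimately show False using small sc tc by auto
  qed
  have mult: "a \<otimes> b \<in> A" if a: "a \<in> A" and b: "b \<in> A" for a b
  proof -
    obtain s r where s: "s \<in> involutions" "a = t \<otimes> s" and r: "r \<in> involutions" "b = t \<otimes> r" using form a b by metis
    define q where "q = t \<otimes> s \<otimes> inv t"
    have q: "q \<in> involutions" unfolding q_def using conj_involution tc s by blast
    have c: "s \<in> carrier G" "r \<in> carrier G" "q \<in> carrier G" "q \<otimes> q = \<one>" "r \<otimes> r = \<one>"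
      using s r q by (auto simp: involutions_def)
    have ab: "a \<otimes> b = q \<otimes> r" using c tc by (simp add: s r q_def m_assoc)
    obtain g where g: "g \<in> carrier G" "q = g \<otimes> t \<otimes> inv g"
    proof (cases "q \<in> cent t")
      case True
      hence "q = t" using small q by (auto simp: involutions_def)
      thus thesis using that[of \<one>] tc by simp
    next
      case False
      thus thesis using noncommuting_involutions_conjugate[OF t q] that by blast
    qed
    show ?thesis
    proof (rule ccontr)
      assume "a \<otimes> b \<notin> A"
      hence "(q \<otimes> r) \<otimes> (q \<otimes> r) = \<one>" "q \<otimes> r \<noteq> \<one>" using ab c by (auto simp: A_def involutions_def)
      moreover from this have "r \<in> cent q"
        using commute_if_square_one[of q r] c by (simp add: cent_def)
      hence "inv g \<otimes> r \<otimes> inv (inv g) \<in> cent (inv g \<otimes> q \<otimes> inv (inv g))"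
        using conj_cent g c by blast
      hence "inv g \<otimes> r \<otimes> g \<in> cent t" using g(1) tc by (simp add: g(2) word_simps)
      hence "g \<otimes> (inv g \<otimes> r \<otimes> g) \<otimes> inv g \<in> {\<one>, q}" using small g by auto
      hence "r = \<one> \<or> r = q" using g(1) c by (simp add: word_simps)
      ultimately show False using c r by (auto simp: involutions_def)
    qed
  qed
  have inverted: "t \<otimes> a \<otimes> t = inv a" if a: "a \<in> A" for a
  proof -
    obtain s where s: "s \<in> involutions" "a = t \<otimes> s" using form a by blast
    hence "s \<in> carrier G" "inv s = s" by (auto simp: involutions_def involution_inv)
    thus ?thesis using tc by (simp add: s word_simps involution_cancel)
  qed
  have Ac: "A \<subseteq> carrier G" by (auto simp: A_def)
  have conjA: "g \<otimes> x \<otimes> inv g \<in> A" if x: "x \<in> A" and g: "g \<in> carrier G" for x g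
  proof (rule ccontr)
    assume "g \<otimes> x \<otimes> inv g \<notin> A"
    hence "g \<otimes> x \<otimes> inv g \<in> involutions" using x g by (auto simp: A_def)
    hence "inv g \<otimes> (g \<otimes> x \<otimes> inv g) \<otimes> inv (inv g) \<in> involutions" using conj_involution g by blast
    thus False using x g by (simp add: A_def word_simps)
  qed
  have invA: "inv x \<in> A" if "x \<in> A" for x
    using conjA[OF that tc(1)] inverted[OF that] tc by simp
  show ?thesis
  proof (rule finite_generate_if_virtually_abelian_torsion)
    show "subgroup A G"
      using mult invA by unfold_locales (auto simp: A_def involutions_def)
    show "x \<otimes> y = y \<otimes> x" if "x \<in> A" "y \<in> A" for x y
    proof -
      have c: "x \<in> carrier G" "y \<in> carrier G" using that Ac by auto
      have "inv (x \<otimes> y) = t \<otimes> (x \<otimes> y) \<otimes> t" using inverted mult that by simp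
      also have "\<dots> = (t \<otimes> x \<otimes> t) \<otimes> (t \<otimes> y \<otimes> t)" using c tc by (simp add: m_assoc involution_cancel)
      also have "\<dots> = inv (y \<otimes> x)" using inverted that c by (simp add: inv_mult_group)
      finally show ?thesis using c by (metis inv_inv m_closed)
    qed
    show "\<exists>n>0::nat. x [^] n = \<one>" if "x \<in> A" for x using torsion that Ac by blast
    show "finite {\<one>, t}" "{\<one>, t} \<subseteq> carrier G" using tc by auto
    show "\<exists>t'\<in>{\<one>, t}. inv t' \<otimes> g \<in> A" if g: "g \<in> carrier G" for g
    proof (cases "g \<in> A")
      case False
      hence "g \<in> involutions" using g by (simp add: A_def)
      thus ?thesis using form'[of g] tc(3) by simp
    qed (use g in auto)
  qed (use B conjA in auto)
qed

section \<open>Two noncommuting involutions: the structure of a Zassenhaus group\<close>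

text \<open>
  For an involution \<open>t\<close> this is the normalizer of \<open>cent t\<close>, that is, the stabilizer of the point
  \<open>cent t\<close> in the action of the group on the centralizers of involutions.
\<close>

definition (in group) cent_normalizer :: "'a \<Rightarrow> 'a set" where
  "cent_normalizer t = {x \<in> carrier G. x \<otimes> t \<otimes> inv x \<in> cent t}"

text \<open>
  For an involution \<open>s\<close> this is the stabilizer of the two points \<open>cent t\<close> and \<open>s (cent t) s\<close>.
\<close>

definition (in group) torus :: "'a \<Rightarrow> 'a \<Rightarrow> 'a set" where
  "torus t s = {x \<in> cent_normalizer t. s \<otimes> x \<otimes> s \<in> cent_normalizer t}"

context square_one_or_odd
begin

lemma involutionD:
  assumes "t \<in> involutions"
  shows "t \<in> carrier G" "t \<otimes> t = \<one>" "inv t = t" "t \<noteq> \<one>"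
  using assms by (auto simp: involutions_def involution_inv)

lemma cent_normalizer_conj:
  assumes "t \<in> involutions" "x \<in> cent_normalizer t" "c \<in> cent t"
  shows "x \<otimes> c \<otimes> inv x \<in> cent t"
proof -
  have x: "x \<in> carrier G" "x \<otimes> t \<otimes> inv x \<in> cent t" using assms by (auto simp: cent_normalizer_def)
  have "x \<otimes> t \<otimes> inv x \<noteq> \<one>" using conj_involution[OF x(1) assms(1)] involutionD(4) by blast
  hence "cent (x \<otimes> t \<otimes> inv x) = cent t" using cent_eq assms x by blast
  thus ?thesis using conj_cent[OF x(1) involutionD(1)[OF assms(1)] assms(3)] by simp
qed

lemma subgroup_cent_normalizer:
  assumes t: "t \<in> involutions"
  shows "subgroup (cent_normalizer t) G"
proof (unfold_locales, goal_cases)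
  case (2 x y)
  have xy: "x \<in> carrier G" "y \<in> carrier G" "y \<otimes> t \<otimes> inv y \<in> cent t" using 2 by (auto simp: cent_normalizer_def)
  have "x \<otimes> (y \<otimes> t \<otimes> inv y) \<otimes> inv x \<in> cent t" using cent_normalizer_conj[OF t 2(1)] xy by blast
  thus ?case using xy involutionD(1)[OF t] by (simp add: cent_normalizer_def word_simps)
next
  case (4 x)
  have x: "x \<in> carrier G" "x \<otimes> t \<otimes> inv x \<in> cent t" using 4 by (auto simp: cent_normalizer_def)
  have i: "x \<otimes> t \<otimes> inv x \<in> involutions" using conj_involution x t by blast
  have "cent (x \<otimes> t \<otimes> inv x) = cent t" using cent_eq[OF t x(2)] involutionD(4)[OF i] by blast
  hence "t \<in> cent (x \<otimes> t \<otimes> inv x)" using involution_in_cent t by blast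
  hence "inv x \<otimes> t \<otimes> inv (inv x) \<in> cent (inv x \<otimes> (x \<otimes> t \<otimes> inv x) \<otimes> inv (inv x))"
    using conj_cent[of "inv x"] x involutionD(1)[OF i] by blast
  also have "inv x \<otimes> (x \<otimes> t \<otimes> inv x) \<otimes> inv (inv x) = t"
    using x involutionD(1)[OF t] by (simp add: word_simps)
  finally show ?case using x by (simp add: cent_normalizer_def)
qed (use involution_in_cent[OF t] involutionD[OF t] in \<open>auto simp: cent_normalizer_def\<close>)

lemma cent_subset_cent_normalizer: "t \<in> involutions \<Longrightarrow> cent t \<subseteq> cent_normalizer t"
proof
  fix x assume t: "t \<in> involutions" and x: "x \<in> cent t"
  hence "x \<otimes> t \<otimes> inv x = t" by (subst conj_eq_iff) (auto simp: cent_def involutions_def)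
  thus "x \<in> cent_normalizer t" using x involution_in_cent[OF t] by (simp add: cent_normalizer_def cent_def)
qed

text \<open>
  If an involution \<open>x\<close> normalizes the centralizer, then \<open>(x t)\<^sup>2\<close> lies in it, so that \<open>x t\<close> has order
  dividing four and therefore two.
\<close>

lemma cent_normalizer_square_one:
  assumes t: "t \<in> involutions" and x: "x \<in> cent_normalizer t" "x \<otimes> x = \<one>"
  shows "x \<in> cent t"
proof -
  note tD = involutionD[OF t]
  have xc: "x \<in> carrier G" "x \<otimes> t \<otimes> inv x \<in> cent t" using x by (auto simp: cent_normalizer_def)
  define q where "q = x \<otimes> t \<otimes> inv x"
  have q: "q \<in> cent t" "q \<in> carrier G" using xc by (auto simp: q_def cent_def)
  have "q \<otimes> t \<in> cent t"
    using subgroup.m_closed[OF subgroup_cent[OF tD(1)] q(1)] involution_in_cent[OF t] by blast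
  hence "(q \<otimes> t) \<otimes> (q \<otimes> t) = \<one>" using cent_square t by blast
  moreover have "q \<otimes> t = (x \<otimes> t) \<otimes> (x \<otimes> t)"
    using xc(1) tD(1) involution_inv[OF xc(1) x(2)] by (simp add: q_def m_assoc)
  ultimately have "(x \<otimes> t) \<otimes> (x \<otimes> t) = \<one>"
    using square_one_if_fourth_power[of "x \<otimes> t"] xc tD by simp
  hence "x \<otimes> t = t \<otimes> x" using commute_if_square_one xc tD x by blast
  thus ?thesis using xc by (simp add: cent_def)
qed

end

locale noncommuting_involutions = square_one_or_odd +
  fixes t s
  assumes t: "t \<in> involutions" and s: "s \<in> involutions" and ts: "s \<notin> cent t"
begin

lemmas tD = involutionD[OF t] and sD = involutionD[OF s]

sublocale N: subgroup "cent_normalizer t" G using subgroup_cent_normalizer t by blast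
sublocale S: subgroup "cent t" G using subgroup_cent tD by blast

lemma s_not_cent_normalizer: "s \<notin> cent_normalizer t"
  using cent_normalizer_square_one[OF t] sD ts by blast

text \<open>
  The conjugate \<open>s d s\<close> also lies in the centralizer of \<open>t\<close>, and \<open>d\<close> times \<open>s d s\<close> is
  centralized by \<open>s\<close>. As \<open>s\<close> centralizes no involution in \<open>cent t\<close>, this product is \<open>\<one>\<close> and
  \<open>s\<close> commutes with \<open>d\<close>; for the same reason \<open>d = \<one>\<close>.
\<close>

lemma torus_in_cent:
  assumes "d \<in> torus t s" "d \<in> cent t"
  shows "d = \<one>"
proof (rule ccontr)
  assume "d \<noteq> \<one>"
  have d: "d \<in> carrier G" "d \<otimes> d = \<one>" "s \<otimes> d \<otimes> s \<in> cent_normalizer t"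
    using assms cent_square[OF t] by (auto simp: torus_def)
  define e where "e = s \<otimes> d \<otimes> s"
  have ec: "e \<in> carrier G" using d sD by (simp add: e_def)
  have "e \<otimes> e = s \<otimes> (d \<otimes> d) \<otimes> s" using d(1) sD by (simp add: e_def m_assoc involution_cancel)
  hence "e \<otimes> e = \<one>" using d sD by simp
  hence e: "e \<in> cent t" using cent_normalizer_square_one[OF t] d by (auto simp: e_def)
  have "d \<otimes> e \<in> cent t" using e assms by blast
  have "s \<otimes> (d \<otimes> e) = (e \<otimes> d) \<otimes> s" using d(1) sD by (simp add: e_def m_assoc)
  also have "e \<otimes> d = d \<otimes> e" using cent_commute[OF t] e assms by blast
  finally have com: "s \<in> cent (d \<otimes> e)" using sD(1) unfolding cent_def by simp
  have "d \<otimes> e = \<one>" using com cent_eq(2)[OF t \<open>d \<otimes> e \<in> cent t\<close>] ts by blast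
  hence "d \<otimes> (d \<otimes> e) = d" using d by simp
  hence "e = d" using involution_cancel[OF d(1,2) ec] by simp
  hence "s \<otimes> d \<otimes> inv s = d" using sD by (simp add: e_def)
  hence "s \<otimes> d = d \<otimes> s" using d(1) sD(1) by (simp only: conj_eq_iff)
  hence "s \<in> cent d" using sD(1) unfolding cent_def by simp
  thus False using cent_eq(2)[OF t assms(2) \<open>d \<noteq> \<one>\<close>] ts by blast
qed

lemma torus_conj: "d \<in> torus t s \<Longrightarrow> s \<otimes> d \<otimes> s \<in> torus t s"
  using sD by (auto simp: torus_def m_assoc involution_cancel)

sublocale D: subgroup "torus t s" G
proof (unfold_locales, goal_cases)
  case (2 x y)
  hence xy: "x \<in> cent_normalizer t" "y \<in> cent_normalizer t" "x \<in> carrier G" "y \<in> carrier G" "s \<otimes> x \<otimes> s \<in> cent_normalizer t" "s \<otimes> y \<otimes> s \<in> cent_normalizer t"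
    by (auto simp: torus_def)
  have "(s \<otimes> x \<otimes> s) \<otimes> (s \<otimes> y \<otimes> s) \<in> cent_normalizer t" using xy by blast
  hence "s \<otimes> (x \<otimes> y) \<otimes> s \<in> cent_normalizer t" using xy(3,4) sD by (simp add: m_assoc involution_cancel)
  thus ?case using xy by (auto simp: torus_def)
next
  case (4 x)
  hence x: "x \<in> cent_normalizer t" "x \<in> carrier G" "s \<otimes> x \<otimes> s \<in> cent_normalizer t" by (auto simp: torus_def)
  have "inv (s \<otimes> x \<otimes> s) \<in> cent_normalizer t" using x by blast
  hence "s \<otimes> inv x \<otimes> s \<in> cent_normalizer t" using x(2) sD by (simp add: word_simps)
  thus ?case using x by (auto simp: torus_def)
qed (use sD in \<open>auto simp: torus_def\<close>)

lemma torus_subset_cent_normalizer: "torus t s \<subseteq> cent_normalizer t"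
  by (auto simp: torus_def)

text \<open>
  The element \<open>s d\<close> interchanges two points and \<open>(s d)\<^sup>2\<close> fixes them. If \<open>s d\<close> had odd order, it
  would be a power of \<open>(s d)\<^sup>2\<close> and fix them too. Hence \<open>s d\<close> is an involution.
\<close>

lemma torus_inverted:
  assumes d: "d \<in> torus t s"
  shows "s \<otimes> d \<otimes> s = inv d"
proof -
  have dc: "d \<in> carrier G" using d by simp
  have "(s \<otimes> d) \<otimes> (s \<otimes> d) = \<one>"
  proof (rule ccontr)
    assume "(s \<otimes> d) \<otimes> (s \<otimes> d) \<noteq> \<one>"
    then obtain m :: nat where "odd m" "(s \<otimes> d) [^] m = \<one>"
      using dichotomy[of "s \<otimes> d"] dc sD by auto
    then obtain k :: nat where k: "(s \<otimes> d) [^] k \<otimes> (s \<otimes> d) [^] k = s \<otimes> d"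
      using odd_square_root[of "s \<otimes> d" m] dc sD by auto
    have "s \<otimes> d = ((s \<otimes> d) \<otimes> (s \<otimes> d)) [^] k"
      using k dc sD by (simp add: pow_mult_distrib)
    also have "(s \<otimes> d) \<otimes> (s \<otimes> d) = (s \<otimes> d \<otimes> s) \<otimes> d" using dc sD by (simp add: m_assoc)
    also have "((s \<otimes> d \<otimes> s) \<otimes> d) [^] k \<in> cent_normalizer t"
    proof -
      have "(s \<otimes> d \<otimes> s) \<otimes> d \<in> cent_normalizer t" using d torus_conj[OF d] torus_subset_cent_normalizer by blast
      thus ?thesis by (induction k) auto
    qed
    finally have "(s \<otimes> d) \<otimes> inv d \<in> cent_normalizer t" using d torus_subset_cent_normalizer by blast
    thus False using s_not_cent_normalizer dc sD by (simp add: m_assoc)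
  qed
  hence "(s \<otimes> d \<otimes> s) \<otimes> d = \<one>" using dc sD by (simp add: m_assoc)
  thus ?thesis using dc sD by (intro inv_equality[symmetric]) auto
qed

lemma torus_commute:
  assumes "d \<in> torus t s" "e \<in> torus t s"
  shows "d \<otimes> e = e \<otimes> d"
proof -
  have c: "d \<in> carrier G" "e \<in> carrier G" using assms by auto
  have "inv (d \<otimes> e) = s \<otimes> (d \<otimes> e) \<otimes> s" using torus_inverted assms by simp
  also have "\<dots> = (s \<otimes> d \<otimes> s) \<otimes> (s \<otimes> e \<otimes> s)" using c sD by (simp add: m_assoc involution_cancel)
  also have "\<dots> = inv (e \<otimes> d)" using torus_inverted assms c by (simp add: inv_mult_group)
  finally show ?thesis using c by (metis inv_inv m_closed)
qed

text \<open>
  Apply \<open>cent_mult_involution\<close> to \<open>x s\<close>, which moves the point: \<open>x s = c r\<close>. Then \<open>c\<^sup>-\<^sup>1 x = r s\<close> is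
  inverted by \<open>s\<close>, so it fixes both points.
\<close>

lemma cent_normalizer_factor:
  assumes x: "x \<in> cent_normalizer t"
  obtains c d where "c \<in> cent t" "d \<in> torus t s" "x = c \<otimes> d"
proof -
  have xc: "x \<in> carrier G" using x by simp
  have "x \<otimes> s \<notin> cent_normalizer t"
  proof
    assume "x \<otimes> s \<in> cent_normalizer t"
    hence "inv x \<otimes> (x \<otimes> s) \<in> cent_normalizer t" using N.m_closed[OF N.m_inv_closed[OF x]] by blast
    thus False using s_not_cent_normalizer xc sD by (simp add: l_inv_cancel)
  qed
  then obtain c r where cr: "c \<in> cent t" "r \<in> involutions" "x \<otimes> s = c \<otimes> r"
    using cent_mult_involution[OF t, of "x \<otimes> s"] xc sD(1) unfolding cent_normalizer_def by blast
  note rD = involutionD[OF cr(2)]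
  have cc: "c \<in> carrier G" using cr by simp
  define d where "d = inv c \<otimes> x"
  have xcd: "x = c \<otimes> d" using cc xc by (simp add: d_def r_inv_cancel)
  have dN: "d \<in> cent_normalizer t" using x cr(1) cent_subset_cent_normalizer[OF t] unfolding d_def by blast
  have "d \<otimes> s = r" using cr(3) cc xc sD rD by (simp add: d_def m_assoc l_inv_cancel)
  hence "d = r \<otimes> s" using inv_solve_right[of d r s] dN sD rD(1) by simp
  hence "s \<otimes> d \<otimes> s = inv d" using sD rD by (simp add: word_simps)
  hence "d \<in> torus t s" using dN by (auto simp: torus_def)
  thus thesis using that cr xcd by blast
qed

lemma torus_free:
  assumes "d \<in> torus t s" "v \<in> cent t" "v \<noteq> \<one>" "d \<otimes> v = v \<otimes> d"
  shows "d = \<one>"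
proof -
  have "d \<in> cent v" using assms(4)[symmetric] D.mem_carrier[OF assms(1)] unfolding cent_def by (intro CollectI conjI)
  hence "d \<in> cent t" using cent_eq(2)[OF t assms(2,3)] by simp
  thus ?thesis using torus_in_cent assms(1) by simp
qed

lemma involutions_conjugate:
  assumes v: "v \<in> involutions"
  obtains g where "g \<in> carrier G" "v = g \<otimes> t \<otimes> inv g"
proof (cases "v \<in> cent t")
  case False
  thus thesis using noncommuting_involutions_conjugate[OF t v] that by blast
next
  case True
  have "s \<notin> cent v" using cent_eq(2)[OF t True] involutionD(4)[OF v] ts by blast
  then obtain g where g: "g \<in> carrier G" "s = g \<otimes> v \<otimes> inv g"
    using noncommuting_involutions_conjugate[OF v s] by blast
  obtain h where h: "h \<in> carrier G" "s = h \<otimes> t \<otimes> inv h"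
    using noncommuting_involutions_conjugate[OF t s ts] by blast
  have "v = inv g \<otimes> s \<otimes> g" using g(1) involutionD(1)[OF v] by (simp add: g(2) word_simps)
  also have "\<dots> = (inv g \<otimes> h) \<otimes> t \<otimes> inv (inv g \<otimes> h)"
    using g(1) h(1) tD by (simp add: h(2) word_simps)
  finally show thesis using that[of "inv g \<otimes> h"] g h by simp
qed

text \<open>
  A conjugating element maps the centralizer to itself, since centralizers that share an
  involution coincide; the factor of it in the abelian group \<open>cent t\<close> can be dropped.
\<close>

lemma torus_transitive:
  assumes v: "v \<in> cent t" "v \<noteq> \<one>"
  obtains d where "d \<in> torus t s" "d \<otimes> t \<otimes> inv d = v"
proof -
  have vI: "v \<in> involutions" using cent_eq(1)[OF t v] .
  then obtain g where g: "g \<in> carrier G" "v = g \<otimes> t \<otimes> inv g" using involutions_conjugate by blast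
  hence "g \<in> cent_normalizer t" using v(1) unfolding cent_normalizer_def by blast
  then obtain c d where cd: "c \<in> cent t" "d \<in> torus t s" "g = c \<otimes> d" using cent_normalizer_factor by blast
  have c: "c \<in> carrier G" "d \<in> carrier G" "v \<in> carrier G"
    using S.mem_carrier cd(1) v(1) D.mem_carrier cd(2) by blast+
  have "d \<otimes> t \<otimes> inv d = inv c \<otimes> v \<otimes> c" using c(1,2) tD by (simp add: g cd word_simps)
  also have "\<dots> = v" using cent_commute[OF t v(1) cd(1)] c by (simp add: m_assoc l_inv_cancel)
  finally show thesis using that cd by blast
qed

end

section \<open>The field on the centralizer of an involution and its finiteness\<close>

lemma (in domain) finite_roots_of_unity:
  assumes "n > 0"
  shows "finite {x \<in> carrier R. x [^] (n::nat) = \<one>}"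
proof -
  define p where "p = \<one> # replicate (n - 1) \<zero> @ [\<ominus> \<one>]"
  have ev: "eval (replicate k \<zero> @ [c]) x = c" if "c \<in> carrier R" "x \<in> carrier R" for k c x
    using that by (induction k) auto
  have "p \<in> carrier (poly_ring R)"
    by (auto simp: p_def simp flip: univ_poly_carrier simp: polynomial_def)
  hence "finite {x. is_root p x}" by (rule finite_number_of_roots)
  moreover have "{x \<in> carrier R. x [^] n = \<one>} \<subseteq> {x. is_root p x}"
  proof safe
    fix x assume x: "x \<in> carrier R" "x [^] n = \<one>"
    have "eval p x = x [^] n \<oplus> \<ominus> \<one>"
      using x(1) assms by (simp add: p_def ev)
    thus "is_root p x" using x by (simp add: is_root_def r_neg) (simp add: p_def)
  qed
  ultimately show ?thesis using finite_subset by blast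
qed

text \<open>
  In geometric terms, \<open>d\<close> fixes only two points: it fixes \<open>cent t\<close> and its images under \<open>s1\<close> and
  \<open>s2\<close>, and these images are claimed to be equal. Both involutions invert \<open>d\<close>, so \<open>s1 s2\<close>
  centralizes it. If \<open>s1 s2\<close> moved the point, then \<open>s2 s1 = c s3\<close> with \<open>c\<close> in
  \<open>cent t\<close> and an involution \<open>s3\<close>, which again inverts \<open>d\<close>. Hence \<open>c\<close> inverts \<open>d\<close>, and the commutator
  \<open>d\<^sup>-\<^sup>2\<close> lies in \<open>cent t\<close>, which meets the torus trivially; so \<open>d\<^sup>2 = \<one>\<close>, and then \<open>d\<close> itself lies there.
\<close>

lemma (in square_one_or_odd) common_fixed_point:
  assumes t: "t \<in> involutions"
    and s1: "s1 \<in> involutions" "s1 \<notin> cent t" "d \<in> torus t s1"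
    and s2: "s2 \<in> involutions" "s2 \<notin> cent t" "d \<in> torus t s2"
    and d: "d \<noteq> \<one>"
  shows "s1 \<otimes> s2 \<in> cent_normalizer t"
proof (rule ccontr)
  interpret A: noncommuting_involutions G t s1 using t s1 by unfold_locales
  interpret B: noncommuting_involutions G t s2 using t s2 by unfold_locales
  note sD = A.sD(1-3) B.sD(1-3)
  assume g: "s1 \<otimes> s2 \<notin> cent_normalizer t"
  have dc: "d \<in> carrier G" using s1 by simp
  have dN: "d \<in> cent_normalizer t" using s1 by (simp add: torus_def)
  have "s2 \<otimes> s1 \<notin> cent_normalizer t"
  proof
    assume "s2 \<otimes> s1 \<in> cent_normalizer t"
    hence "inv (s2 \<otimes> s1) \<in> cent_normalizer t" by (rule A.N.m_inv_closed)
    thus False using g sD by (simp add: inv_mult_group)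
  qed
  then obtain c s3 where c: "c \<in> cent t" and s3: "s3 \<in> involutions" and eq: "s2 \<otimes> s1 = c \<otimes> s3"
    using cent_mult_involution[OF t, of "s2 \<otimes> s1"] sD unfolding cent_normalizer_def by blast
  have s3t: "s3 \<notin> cent t"
  proof
    assume "s3 \<in> cent t"
    hence "s2 \<otimes> s1 \<in> cent_normalizer t" using eq A.S.m_closed[OF c] cent_subset_cent_normalizer[OF t] by auto
    thus False using \<open>s2 \<otimes> s1 \<notin> cent_normalizer t\<close> by simp
  qed
  interpret C: noncommuting_involutions G t s3 using t s3 s3t by unfold_locales
  have cc: "c \<in> carrier G" using c by simp
  have comm: "s2 \<otimes> s1 \<otimes> d \<otimes> s1 \<otimes> s2 = d"
  proof -
    have "s2 \<otimes> s1 \<otimes> d \<otimes> s1 \<otimes> s2 = s2 \<otimes> (s1 \<otimes> d \<otimes> s1) \<otimes> s2" using sD dc by (simp add: m_assoc)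
    also have "\<dots> = inv (inv d)"
      using A.torus_inverted[OF s1(3)] B.torus_inverted[OF B.D.m_inv_closed[OF s2(3)]] by simp
    finally show ?thesis using dc by simp
  qed
  have s3c: "s3 \<otimes> d \<otimes> s3 = inv c \<otimes> d \<otimes> c"
  proof -
    have "s3 = inv c \<otimes> (s2 \<otimes> s1)" using cc C.sD by (simp add: eq l_inv_cancel)
    moreover from this have "inv s3 = (s1 \<otimes> s2) \<otimes> c" using cc sD by (simp add: word_simps)
    ultimately have "s3 \<otimes> d \<otimes> inv s3 = inv c \<otimes> (s2 \<otimes> s1 \<otimes> d \<otimes> s1 \<otimes> s2) \<otimes> c"
      using cc sD dc by (simp add: m_assoc)
    thus ?thesis using comm C.sD by simp
  qed
  also have "inv c \<otimes> d \<otimes> c \<in> cent_normalizer t" using c cent_subset_cent_normalizer[OF t] dN by blast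
  finally have "d \<in> torus t s3" using dN by (simp add: torus_def)
  hence inverted: "inv c \<otimes> d \<otimes> c = inv d" using C.torus_inverted s3c by simp
  have "inv d \<otimes> inv d = inv c \<otimes> (d \<otimes> c \<otimes> inv d)"
    using cc dc inverted by (simp add: m_assoc[symmetric])
  also have "\<dots> \<in> cent t" using A.S.m_closed[OF A.S.m_inv_closed[OF c]] cent_normalizer_conj[OF t dN c] by blast
  finally have "inv d \<otimes> inv d = \<one>" using A.torus_in_cent s1(3) by blast
  hence "d \<otimes> d = \<one>" using dc by (metis inv_mult_group inv_one inv_inv m_closed)
  hence "d \<in> cent t" using cent_normalizer_square_one[OF t dN] by simp
  thus False using A.torus_in_cent s1 d by blast
qed

context noncommuting_involutions
begin

lemma torus_conj_inj:
  assumes de: "d \<in> torus t s" "e \<in> torus t s" "d \<otimes> t \<otimes> inv d = e \<otimes> t \<otimes> inv e"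
  shows "d = e"
proof -
  have c: "d \<in> carrier G" "e \<in> carrier G" using de(1,2) by simp_all
  have "inv e \<otimes> (d \<otimes> t \<otimes> inv d) \<otimes> e = inv e \<otimes> (e \<otimes> t \<otimes> inv e) \<otimes> e" using de(3) by simp
  hence "(inv e \<otimes> d) \<otimes> t \<otimes> inv (inv e \<otimes> d) = t" using c tD(1) by (simp add: word_simps)
  hence "(inv e \<otimes> d) \<otimes> t = t \<otimes> (inv e \<otimes> d)"
    using conj_eq_iff[of "inv e \<otimes> d" t t] c tD(1) by simp
  hence "inv e \<otimes> d = \<one>"
    using torus_free[OF D.m_closed[OF D.m_inv_closed[OF de(2)] de(1)] involution_in_cent[OF t] tD(4)] by simp
  hence "e \<otimes> (inv e \<otimes> d) = e" using c by simp
  thus "d = e" using c by (simp add: r_inv_cancel)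
qed

text \<open>
  Since the abelian group \<open>torus t s\<close> permutes the nonidentity elements of \<open>cent t\<close> regularly, its
  multiplication can be transported to \<open>cent t\<close> along the bijection sending \<open>d\<close> to the conjugate of \<open>t\<close>
  by \<open>d\<close>. Together with the group operation as addition this is a field, in which all nonzero
  elements are roots of unity of exponent \<open>n\<close>.
\<close>

lemma cent_finite_if_torus_exponent:
  assumes n: "n > 0" "\<And>d. d \<in> torus t s \<Longrightarrow> d [^] (n::nat) = \<one>"
  shows "finite (cent t)"
proof -
  define \<delta> where "\<delta> x = (SOME d. d \<in> torus t s \<and> d \<otimes> t \<otimes> inv d = x)" for x
  have \<delta>: "\<delta> x \<in> torus t s" "\<delta> x \<otimes> t \<otimes> inv (\<delta> x) = x" if "x \<in> cent t" "x \<noteq> \<one>" for x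
    using someI_ex[of "\<lambda>d. d \<in> torus t s \<and> d \<otimes> t \<otimes> inv d = x"] torus_transitive[OF that] unfolding \<delta>_def by blast+
  have conjc: "d \<otimes> x \<otimes> inv d \<in> cent t" if "d \<in> torus t s" "x \<in> cent t" for d x
    using cent_normalizer_conj[OF t] that torus_subset_cent_normalizer by blast
  define K where "K = \<lparr>carrier = cent t, monoid.mult = (\<lambda>x y. if x = \<one> then \<one> else \<delta> x \<otimes> y \<otimes> inv (\<delta> x)),
     one = t, zero = \<one>, add = (\<otimes>)\<rparr>"
  have K: "carrier K = cent t" "\<one>\<^bsub>K\<^esub> = t" "\<zero>\<^bsub>K\<^esub> = \<one>" "\<And>x y. x \<oplus>\<^bsub>K\<^esub> y = x \<otimes> y"
    by (auto simp: K_def)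
  have K0: "\<one> \<otimes>\<^bsub>K\<^esub> y = \<one>" "x \<in> cent t \<Longrightarrow> x \<otimes>\<^bsub>K\<^esub> \<one> = \<one>" for x y
    using \<delta> by (auto simp: K_def)
  have form: "\<exists>d \<in> torus t s. x = d \<otimes> t \<otimes> inv d" if "x \<in> cent t" "x \<noteq> \<one>" for x
    using \<delta>(2)[OF that, symmetric] \<delta>(1)[OF that] by (rule bexI)
  have ne: "d \<otimes> t \<otimes> inv d \<noteq> \<one>" if "d \<in> torus t s" for d
    using tD(1,4) D.mem_carrier[OF that] by (subst conj_eq_iff) simp_all
  have mult: "(d \<otimes> t \<otimes> inv d) \<otimes>\<^bsub>K\<^esub> y = d \<otimes> y \<otimes> inv d" if "d \<in> torus t s" for d y
  proof -
    have x: "d \<otimes> t \<otimes> inv d \<in> cent t" using conjc that involution_in_cent[OF t] by blast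
    have "\<delta> (d \<otimes> t \<otimes> inv d) = d" using torus_conj_inj[OF _ that] \<delta>[OF x ne[OF that]] by blast
    thus ?thesis using ne[OF that] by (simp add: K_def)
  qed
  have closed: "x \<otimes>\<^bsub>K\<^esub> y \<in> cent t" if xy: "x \<in> cent t" "y \<in> cent t" for x y
  proof (cases "x = \<one>")
    case False
    obtain d where d: "d \<in> torus t s" "x = d \<otimes> t \<otimes> inv d" using form[OF xy(1) False] by blast
    show ?thesis unfolding d(2) mult[OF d(1)] using conjc[OF d(1) xy(2)] .
  qed (simp add: K0(1))
  have multt: "(d \<otimes> t \<otimes> inv d) \<otimes>\<^bsub>K\<^esub> (e \<otimes> t \<otimes> inv e) = (d \<otimes> e) \<otimes> t \<otimes> inv (d \<otimes> e)"
    if "d \<in> torus t s" "e \<in> torus t s" for d e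
    using tD(1) D.mem_carrier[OF that(1)] D.mem_carrier[OF that(2)]
    by (subst mult[OF that(1)]) (simp add: word_simps)
  have comm: "x \<otimes>\<^bsub>K\<^esub> y = y \<otimes>\<^bsub>K\<^esub> x" if xy: "x \<in> cent t" "y \<in> cent t" for x y
  proof (cases "x = \<one> \<or> y = \<one>")
    case True
    thus ?thesis using K0(1) K0(2)[OF xy(1)] K0(2)[OF xy(2)] by auto
  next
    case False
    obtain d where d: "d \<in> torus t s" "x = d \<otimes> t \<otimes> inv d" using form[OF xy(1)] False by blast
    obtain e where e: "e \<in> torus t s" "y = e \<otimes> t \<otimes> inv e" using form[OF xy(2)] False by blast
    show ?thesis unfolding d(2) e(2) multt[OF d(1) e(1)] multt[OF e(1) d(1)]
      using torus_commute[OF d(1) e(1)] by simp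
  qed
  have distl: "x \<otimes>\<^bsub>K\<^esub> (y \<otimes> z) = (x \<otimes>\<^bsub>K\<^esub> y) \<otimes> (x \<otimes>\<^bsub>K\<^esub> z)"
    if xyz: "x \<in> cent t" "y \<in> cent t" "z \<in> cent t" for x y z
  proof (cases "x = \<one>")
    case False
    obtain d where d: "d \<in> torus t s" "x = d \<otimes> t \<otimes> inv d" using form[OF xyz(1) False] by blast
    show ?thesis unfolding d(2) mult[OF d(1)]
      using S.mem_carrier[OF xyz(2)] S.mem_carrier[OF xyz(3)] D.mem_carrier[OF d(1)]
      by (simp add: word_simps)
  qed (simp add: K0)
  have assoc: "(x \<otimes>\<^bsub>K\<^esub> y) \<otimes>\<^bsub>K\<^esub> z = x \<otimes>\<^bsub>K\<^esub> (y \<otimes>\<^bsub>K\<^esub> z)"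
    if xyz: "x \<in> cent t" "y \<in> cent t" "z \<in> cent t" for x y z
  proof (cases "x = \<one> \<or> y = \<one>")
    case True
    thus ?thesis using K0(1) K0(2)[OF xyz(1)] by auto
  next
    case False
    obtain d where d: "d \<in> torus t s" "x = d \<otimes> t \<otimes> inv d" using form[OF xyz(1)] False by blast
    obtain e where e: "e \<in> torus t s" "y = e \<otimes> t \<otimes> inv e" using form[OF xyz(2)] False by blast
    show ?thesis
      unfolding d(2) e(2) multt[OF d(1) e(1)] mult[OF D.m_closed[OF d(1) e(1)]]
      unfolding mult[OF e(1)] mult[OF d(1)]
      using S.mem_carrier[OF xyz(3)] D.mem_carrier[OF d(1)] D.mem_carrier[OF e(1)]
      by (simp add: word_simps)
  qed
  have one: "t \<otimes>\<^bsub>K\<^esub> x = x" if "x \<in> cent t" for x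
    using mult[OF D.one_closed, of x] tD(1) S.mem_carrier[OF that] by simp
  interpret K: cring K
  proof (rule cringI)
    show "abelian_group K"
    proof (rule abelian_groupI)
      fix x assume "x \<in> carrier K"
      hence "x \<in> cent t" by (simp add: K)
      hence "x \<otimes> x = \<one>" using cent_square[OF t] by blast
      thus "\<exists>y\<in>carrier K. y \<oplus>\<^bsub>K\<^esub> x = \<zero>\<^bsub>K\<^esub>" using \<open>x \<in> cent t\<close> by (intro bexI[of _ x]) (simp_all add: K)
    next
      fix x y assume "x \<in> carrier K" "y \<in> carrier K"
      thus "x \<oplus>\<^bsub>K\<^esub> y = y \<oplus>\<^bsub>K\<^esub> x" using cent_commute[OF t] unfolding K by blast
    qed (simp_all add: K m_assoc)
    show "comm_monoid K"
    proof (rule comm_monoidI, unfold K)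
      show "t \<in> cent t" using involution_in_cent[OF t] .
    qed (fact closed assoc one comm)+
    show "(x \<oplus>\<^bsub>K\<^esub> y) \<otimes>\<^bsub>K\<^esub> z = x \<otimes>\<^bsub>K\<^esub> z \<oplus>\<^bsub>K\<^esub> y \<otimes>\<^bsub>K\<^esub> z"
      if "x \<in> carrier K" "y \<in> carrier K" "z \<in> carrier K" for x y z
    proof -
      have c: "x \<in> cent t" "y \<in> cent t" "z \<in> cent t" using that by (simp_all add: K)
      show ?thesis unfolding K
        using distl[OF c(3,1,2)] unfolding comm[OF c(3,1)] comm[OF c(3,2)] comm[OF c(3) S.m_closed[OF c(1,2)]] .
    qed
  qed
  have "domain K"
  proof (unfold_locales)
    show "\<one>\<^bsub>K\<^esub> \<noteq> \<zero>\<^bsub>K\<^esub>" using tD by (simp add: K)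
    show "a = \<zero>\<^bsub>K\<^esub> \<or> b = \<zero>\<^bsub>K\<^esub>" if ab: "a \<otimes>\<^bsub>K\<^esub> b = \<zero>\<^bsub>K\<^esub>" "a \<in> carrier K" "b \<in> carrier K" for a b
    proof (rule ccontr)
      assume "\<not> (a = \<zero>\<^bsub>K\<^esub> \<or> b = \<zero>\<^bsub>K\<^esub>)"
      hence *: "a \<noteq> \<one>" "b \<noteq> \<one>" "a \<in> cent t" "b \<in> cent t" using ab(2,3) by (simp_all add: K)
      then obtain d where d: "d \<in> torus t s" "a = d \<otimes> t \<otimes> inv d" using form[of a] by blast
      have "d \<otimes> b \<otimes> inv d = \<one>" using ab(1) mult[OF d(1)] d(2) by (simp add: K)
      hence "d \<otimes> b = \<one> \<otimes> d" using conj_eq_iff[of d b \<one>] D.mem_carrier[OF d(1)] S.mem_carrier[OF *(4)] by blast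
      thus False using *(2) D.mem_carrier[OF d(1)] S.mem_carrier[OF *(4)] by simp
    qed
  qed
  then interpret K: domain K .
  have pow: "(d \<otimes> t \<otimes> inv d) [^]\<^bsub>K\<^esub> (k::nat) = d [^] k \<otimes> t \<otimes> inv (d [^] k)" if d: "d \<in> torus t s" for d k
  proof (induction k)
    case 0
    show ?case using tD by (simp add: K)
  next
    case (Suc k)
    have "d [^] k \<in> torus t s" using d by (induction k) auto
    thus ?case using Suc multt[of "d [^] k" d] d by simp
  qed
  have "cent t - {\<one>} \<subseteq> {x \<in> carrier K. x [^]\<^bsub>K\<^esub> n = \<one>\<^bsub>K\<^esub>}"
  proof
    fix x assume x: "x \<in> cent t - {\<one>}"
    then obtain d where d: "d \<in> torus t s" "x = d \<otimes> t \<otimes> inv d" using form by blast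
    have "x [^]\<^bsub>K\<^esub> n = t" using pow[OF d(1)] n(2)[OF d(1)] tD d(2) by simp
    thus "x \<in> {x \<in> carrier K. x [^]\<^bsub>K\<^esub> n = \<one>\<^bsub>K\<^esub>}" using x by (simp add: K)
  qed
  hence "finite (cent t - {\<one>})" using K.finite_roots_of_unity[OF n(1)] finite_subset by blast
  thus ?thesis by simp
qed

text \<open>
  It is enough to bound the number of points, that is, to see that \<open>cent t\<close> permutes the
  other points transitively. Given two of them, choose \<open>d \<noteq> \<one>\<close> fixing the first one and \<open>cent t\<close>.
  Modulo \<open>cent t\<close> it agrees with some \<open>d'\<close> fixing the second one and \<open>cent t\<close>, and since \<open>cent t\<close> is finite
  the elements \<open>d\<close> and \<open>d'\<close> are conjugate by some \<open>e\<close> in \<open>cent t\<close>. By \<open>common_fixed_point\<close> this \<open>e\<close>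
  maps the first point to the second.
\<close>

lemma finite_carrier_if_finite_cent:
  assumes fin: "finite (cent t)" and v: "v \<in> cent t" "v \<noteq> \<one>" "v \<noteq> t"
  shows "finite (carrier G)"
proof -
  have "inj_on (\<lambda>d. d \<otimes> t \<otimes> inv d) (torus t s)"
    using torus_conj_inj by (rule inj_onI)
  moreover have "(\<lambda>d. d \<otimes> t \<otimes> inv d) ` torus t s \<subseteq> cent t"
    using cent_normalizer_conj[OF t _ involution_in_cent[OF t]] torus_subset_cent_normalizer by blast
  ultimately have finD: "finite (torus t s)" using fin finite_subset finite_imageD by metis
  obtain d where d: "d \<in> torus t s" "d \<otimes> t \<otimes> inv d = v" using torus_transitive[OF v(1,2)] .
  have d1: "d \<noteq> \<one>" using d v tD by auto
  have dc: "d \<in> carrier G" using d by simp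
  have onto: "\<exists>e\<in>cent t. e \<otimes> d \<otimes> inv e = c \<otimes> d" if c: "c \<in> cent t" for c
  proof -
    \<comment> \<open>Injective because \<open>d\<close> commutes with no involution of \<open>cent t\<close>; finiteness makes it surjective.\<close>
    define \<phi> where "\<phi> e = e \<otimes> (d \<otimes> inv e \<otimes> inv d)" for e
    have "\<phi> ` cent t \<subseteq> cent t"
    proof
      fix x assume "x \<in> \<phi> ` cent t"
      then obtain e where e: "e \<in> cent t" "x = \<phi> e" by blast
      have "d \<otimes> inv e \<otimes> inv d \<in> cent t" using cent_normalizer_conj[OF t _ S.m_inv_closed[OF e(1)]] d torus_subset_cent_normalizer by blast
      thus "x \<in> cent t" using e by (simp add: \<phi>_def)
    qed
    moreover have "inj_on \<phi> (cent t)"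
    proof (rule inj_onI)
      fix e f assume ef: "e \<in> cent t" "f \<in> cent t" "\<phi> e = \<phi> f"
      have c: "e \<in> carrier G" "f \<in> carrier G" using ef by simp_all
      define h where "h = inv f \<otimes> e"
      have h: "h \<in> cent t" "h \<in> carrier G" using ef c by (auto simp: h_def)
      have "inv f \<otimes> (\<phi> e) \<otimes> d = inv f \<otimes> (\<phi> f) \<otimes> d" using ef by simp
      hence "h \<otimes> d \<otimes> inv e = d \<otimes> inv f" using c dc by (simp add: \<phi>_def h_def word_simps)
      hence "h \<otimes> d \<otimes> inv e \<otimes> e = d \<otimes> inv f \<otimes> e" by simp
      hence "d \<otimes> h = h \<otimes> d" using c dc by (simp add: h_def word_simps)
      hence "h = \<one>" using torus_free[OF d(1) h(1)] d1 by blast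
      thus "e = f" using c by (metis h_def inv_equality inv_inv inv_closed)
    qed
    ultimately have "\<phi> ` cent t = cent t" using fin endo_inj_surj by blast
    then obtain e where e: "e \<in> cent t" "\<phi> e = c" using c by (metis imageE)
    have ec: "e \<in> carrier G" using e by simp
    have "c \<otimes> d = e \<otimes> d \<otimes> inv e" using ec dc by (simp add: e(2)[symmetric] \<phi>_def word_simps)
    thus ?thesis using e by auto
  qed
  have swap: "\<exists>e\<in>cent t. \<exists>n\<in>cent_normalizer t. r = e \<otimes> s \<otimes> inv e \<otimes> n"
    if r: "r \<in> involutions" "r \<notin> cent t" for r
  proof -
    interpret R: noncommuting_involutions G t r using r t by unfold_locales
    obtain c d' where cd: "c \<in> cent t" "d' \<in> torus t r" "d = c \<otimes> d'" using R.cent_normalizer_factor d torus_subset_cent_normalizer by blast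
    have c: "c \<in> carrier G" "d' \<in> carrier G" using cd by simp_all
    obtain e where e: "e \<in> cent t" "e \<otimes> d \<otimes> inv e = inv c \<otimes> d" using onto[OF S.m_inv_closed[OF cd(1)]] by blast
    have ec: "e \<in> carrier G" using e by simp
    have d': "d' = e \<otimes> d \<otimes> inv e" using c e cd by (simp add: l_inv_cancel)
    have d'1: "d' \<noteq> \<one>" using d1 dc ec by (subst d', subst conj_eq_iff) auto
    define q where "q = e \<otimes> s \<otimes> inv e"
    have q: "q \<in> involutions" unfolding q_def using conj_involution[OF ec s] .
    have qt: "q \<notin> cent t"
    proof
      assume "q \<in> cent t"
      hence "inv e \<otimes> q \<otimes> e \<in> cent t" using e by blast
      thus False using ts ec sD by (simp add: q_def word_simps)
    qed
    have "q \<otimes> d' \<otimes> q = e \<otimes> (s \<otimes> d \<otimes> s) \<otimes> inv e"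
      using ec sD(1) dc by (simp add: q_def d' word_simps)
    also have "\<dots> \<in> cent_normalizer t"
      using e cent_subset_cent_normalizer[OF t] torus_conj[OF d(1)] torus_subset_cent_normalizer by blast
    finally have "d' \<in> torus t q" using R.torus_subset_cent_normalizer cd by (auto simp: torus_def)
    hence "q \<otimes> r \<in> cent_normalizer t" using common_fixed_point[OF t q qt _ r cd(2) d'1] by blast
    moreover have "r = q \<otimes> (q \<otimes> r)" using involutionD[OF q] R.sD by (simp add: involution_cancel)
    ultimately show ?thesis using e q_def by blast
  qed
  have refl: "\<exists>r\<in>involutions. r \<notin> cent t \<and> w = r \<otimes> t \<otimes> r" if w: "w \<in> involutions" "w \<notin> cent t" for w
  proof -
    obtain g where g: "g \<in> carrier G" "w = g \<otimes> t \<otimes> inv g" using involutions_conjugate[OF w(1)] .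
    have gN: "inv g \<notin> cent_normalizer t"
    proof
      assume "inv g \<in> cent_normalizer t"
      hence "inv (inv g) \<in> cent_normalizer t" by (rule N.m_inv_closed)
      hence "g \<in> cent_normalizer t" using g(1) by simp
      hence "g \<otimes> t \<otimes> inv g \<in> cent t" unfolding cent_normalizer_def by blast
      thus False using w(2) unfolding g(2) by contradiction
    qed
    hence "inv g \<otimes> t \<otimes> inv (inv g) \<notin> cent t" using g(1) unfolding cent_normalizer_def by blast
    then obtain c r where cr: "c \<in> cent t" "r \<in> involutions" "inv g = c \<otimes> r"
      using cent_mult_involution[OF t inv_closed[OF g(1)]] by blast
    have "r \<notin> cent t"
    proof
      assume "r \<in> cent t"
      hence "c \<otimes> r \<in> cent_normalizer t" using S.m_closed[OF cr(1)] cent_subset_cent_normalizer[OF t] by blast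
      thus False using gN cr(3) by simp
    qed
    have cc: "c \<in> carrier G" "c \<otimes> t = t \<otimes> c" using cr(1) unfolding cent_def by simp_all
    note rD = involutionD[OF cr(2)]
    have "g = inv (c \<otimes> r)" using g(1) by (simp flip: cr(3))
    hence "g = r \<otimes> inv c" using cc rD by (simp add: inv_mult_group)
    hence "w = r \<otimes> (inv c \<otimes> (t \<otimes> c)) \<otimes> r" using cc(1) rD tD unfolding g(2) by (simp add: word_simps)
    also have "inv c \<otimes> (t \<otimes> c) = t" unfolding cc(2)[symmetric] using cc(1) tD by (simp add: l_inv_cancel)
    finally show ?thesis using cr \<open>r \<notin> cent t\<close> by blast
  qed
  have "involutions \<subseteq> cent t \<union> (\<lambda>(e, c). (e \<otimes> s \<otimes> inv e) \<otimes> c \<otimes> (e \<otimes> s \<otimes> inv e)) ` (cent t \<times> cent t)"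
  proof
    fix w assume w: "w \<in> involutions"
    show "w \<in> cent t \<union> (\<lambda>(e, c). (e \<otimes> s \<otimes> inv e) \<otimes> c \<otimes> (e \<otimes> s \<otimes> inv e)) ` (cent t \<times> cent t)"
    proof (cases "w \<in> cent t")
      case False
      obtain r where r: "r \<in> involutions" "r \<notin> cent t" "w = r \<otimes> t \<otimes> r" using refl[OF w False] by blast
      obtain e n where en: "e \<in> cent t" "n \<in> cent_normalizer t" "r = e \<otimes> s \<otimes> inv e \<otimes> n" using swap[OF r(1,2)] by blast
      note rD = involutionD[OF r(1)]
      have c: "e \<in> carrier G" "n \<in> carrier G" using en by simp_all
      define q where "q = e \<otimes> s \<otimes> inv e"
      note qD = involutionD[OF conj_involution[OF c(1) s], folded q_def]
      have "w = r \<otimes> t \<otimes> inv r" using r rD by simp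
      also have "\<dots> = q \<otimes> (n \<otimes> t \<otimes> inv n) \<otimes> q"
        unfolding en(3) q_def[symmetric] using c qD tD by (simp add: word_simps)
      finally have eq: "w = q \<otimes> (n \<otimes> t \<otimes> inv n) \<otimes> q" .
      have "n \<otimes> t \<otimes> inv n \<in> cent t" using en(2) unfolding cent_normalizer_def by blast
      thus ?thesis using en(1)
        by (intro UnI2 image_eqI[of _ _ "(e, n \<otimes> t \<otimes> inv n)"]) (simp_all add: eq q_def)
    qed simp
  qed
  hence finI: "finite involutions" by (rule finite_subset) (use fin in simp)
  have "carrier G \<subseteq> (\<lambda>(c, d). c \<otimes> d) ` (cent t \<times> torus t s) \<union> (\<lambda>(c, r). c \<otimes> r) ` (cent t \<times> involutions)"
  proof
    fix x assume x: "x \<in> carrier G"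
    show "x \<in> (\<lambda>(c, d). c \<otimes> d) ` (cent t \<times> torus t s) \<union> (\<lambda>(c, r). c \<otimes> r) ` (cent t \<times> involutions)"
    proof (cases "x \<in> cent_normalizer t")
      case True
      then obtain c d where "c \<in> cent t" "d \<in> torus t s" "x = c \<otimes> d" by (rule cent_normalizer_factor)
      thus ?thesis by (intro UnI1 image_eqI[of _ _ "(c, d)"]) simp_all
    next
      case False
      hence "x \<otimes> t \<otimes> inv x \<notin> cent t" using x unfolding cent_normalizer_def by blast
      then obtain c r where "c \<in> cent t" "r \<in> involutions" "x = c \<otimes> r"
        using cent_mult_involution[OF t x] by blast
      thus ?thesis by (intro UnI2 image_eqI[of _ _ "(c, r)"]) simp_all
    qed
  qed
  thus ?thesis by (rule finite_subset) (use fin finD finI in simp)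
qed

end

text \<open>
  Commuting elements of prime power order whose product has prime power order belong to the same
  prime, so the abelian torus is a \<open>p\<close>-group.
\<close>

lemma (in noncommuting_involutions) cent_finite_if_bounded_prime_power:
  assumes prime_power: "\<And>x. x \<in> carrier G \<Longrightarrow> \<exists>p k. Factorial_Ring.prime (p::nat) \<and> x [^] (p ^ k) = \<one>"
    and bounded: "\<And>p. Factorial_Ring.prime (p::nat) \<Longrightarrow>
      \<exists>n>0. \<forall>x\<in>carrier G. (\<exists>k. x [^] (p ^ k) = \<one>) \<longrightarrow> x [^] (n::nat) = \<one>"
  shows "finite (cent t)"
proof (cases "torus t s = {\<one>}")
  case True
  thus ?thesis using cent_finite_if_torus_exponent[of 1] by simp
next
  case False
  then obtain d where d: "d \<in> torus t s" "d \<noteq> \<one>" using D.one_closed by blast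
  obtain p k where p: "Factorial_Ring.prime (p::nat)" "d [^] (p ^ k) = \<one>" using prime_power[OF D.mem_carrier[OF d(1)]] by blast
  obtain n :: nat where n: "n > 0" "\<forall>x\<in>carrier G. (\<exists>k. x [^] (p ^ k) = \<one>) \<longrightarrow> x [^] n = \<one>"
    using bounded[OF p(1)] by blast
  show ?thesis
  proof (rule cent_finite_if_torus_exponent[OF n(1)])
    fix e assume e: "e \<in> torus t s"
    show "e [^] n = \<one>"
    proof (cases "e = \<one>")
      case False
      note c = D.mem_carrier[OF d(1)] D.mem_carrier[OF e]
      obtain q j where q: "Factorial_Ring.prime (q::nat)" "e [^] (q ^ j) = \<one>" using prime_power[OF c(2)] by blast
      obtain r l where r: "Factorial_Ring.prime (r::nat)" "(d \<otimes> e) [^] (r ^ l) = \<one>"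
        using prime_power[OF m_closed[OF c]] by blast
      have "p = q"
        by (rule commuting_prime_power_same_prime[OF c torus_commute[OF d(1) e] d(2) False p q r])
      thus ?thesis using n(2) q(2) c(2) by blast
    qed simp
  qed
qed

section \<open>Commuting involutions: elements of order three acting freely\<close>

definition (in group) two_part :: "'a set" where
  "two_part = {x \<in> carrier G. x \<otimes> x = \<one>}"

definition (in group) act :: "'a \<Rightarrow> 'a \<Rightarrow> 'a" where
  "act g v = g \<otimes> v \<otimes> inv g"

locale commuting_involutions = square_one_or_odd +
  assumes commuting: "\<lbrakk>x \<in> involutions; y \<in> involutions\<rbrakk> \<Longrightarrow> x \<otimes> y = y \<otimes> x"
    and nonempty: "involutions \<noteq> {}"
begin

lemma two_part_eq: "two_part = insert \<one> involutions"
  by (auto simp: two_part_def involutions_def)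

lemma two_partI: "\<lbrakk>x \<in> carrier G; x \<otimes> x = \<one>\<rbrakk> \<Longrightarrow> x \<in> two_part"
  by (simp add: two_part_def)

lemma two_part_square: "v \<in> two_part \<Longrightarrow> v \<otimes> v = \<one>"
  by (simp add: two_part_def)

lemma two_part_commute:
  assumes "v \<in> two_part" "w \<in> two_part"
  shows "v \<otimes> w = w \<otimes> v"
proof (cases "v = \<one> \<or> w = \<one>")
  case True
  thus ?thesis using assms by (auto simp: two_part_def)
next
  case False
  thus ?thesis using assms commuting unfolding two_part_eq by blast
qed

sublocale N: subgroup two_part G
proof (unfold_locales, goal_cases)
  case (2 x y)
  have c: "x \<in> carrier G" "y \<in> carrier G" "x \<otimes> x = \<one>" "y \<otimes> y = \<one>" using 2 by (simp_all add: two_part_def)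
  have "(x \<otimes> y) \<otimes> (x \<otimes> y) = (x \<otimes> y) \<otimes> (y \<otimes> x)" using two_part_commute[OF 2] by simp
  also have "\<dots> = \<one>" using c by (simp add: m_assoc involution_cancel)
  finally show ?case using c by (simp add: two_part_def)
next
  case (4 x)
  thus ?case by (simp add: two_part_def involution_inv)
qed (auto simp: two_part_def)

lemma two_part_square_left: "\<lbrakk>v \<in> two_part; w \<in> two_part\<rbrakk> \<Longrightarrow> v \<otimes> (v \<otimes> w) = w"
  by (intro involution_cancel two_part_square N.mem_carrier)

lemma two_part_left_commute: "\<lbrakk>v \<in> two_part; w \<in> two_part; y \<in> two_part\<rbrakk> \<Longrightarrow> v \<otimes> (w \<otimes> y) = w \<otimes> (v \<otimes> y)"
proof -
  assume vwy: "v \<in> two_part" "w \<in> two_part" "y \<in> two_part"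
  hence c: "v \<in> carrier G" "w \<in> carrier G" "y \<in> carrier G" by simp_all
  show ?thesis
    unfolding m_assoc[OF c, symmetric] m_assoc[OF c(2,1,3), symmetric] two_part_commute[OF vwy(1,2)] ..
qed

lemma two_part_assoc: "\<lbrakk>v \<in> two_part; w \<in> two_part; y \<in> two_part\<rbrakk> \<Longrightarrow> (v \<otimes> w) \<otimes> y = v \<otimes> (w \<otimes> y)"
  by (intro m_assoc N.mem_carrier)

lemmas two_part_simps = two_part_assoc two_part_commute two_part_left_commute two_part_square two_part_square_left

lemma two_part_cancel: "\<lbrakk>v \<in> two_part; w \<in> two_part; v \<otimes> w = \<one>\<rbrakk> \<Longrightarrow> v = w"
proof -
  assume vw: "v \<in> two_part" "w \<in> two_part" "v \<otimes> w = \<one>"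
  have "w = v \<otimes> (v \<otimes> w)" using two_part_square_left[OF vw(1,2)] by (rule sym)
  thus "v = w" unfolding vw(3) r_one[OF N.mem_carrier[OF vw(1)]] by (rule sym)
qed

lemma act_in [simp]: "\<lbrakk>g \<in> carrier G; v \<in> two_part\<rbrakk> \<Longrightarrow> act g v \<in> two_part"
proof -
  assume g: "g \<in> carrier G" and v: "v \<in> two_part"
  have c: "v \<in> carrier G" using v by simp
  have "act g v \<otimes> act g v = g \<otimes> (v \<otimes> v) \<otimes> inv g"
    using g c by (simp add: act_def m_assoc l_inv_cancel)
  also have "\<dots> = \<one>" unfolding two_part_square[OF v] using g by simp
  finally show "act g v \<in> two_part" using g c by (intro two_partI) (simp_all add: act_def)
qed

lemma act_mult: "\<lbrakk>g \<in> carrier G; v \<in> two_part; w \<in> two_part\<rbrakk> \<Longrightarrow> act g (v \<otimes> w) = act g v \<otimes> act g w"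
  by (simp add: act_def word_simps)

lemma act_comp: "\<lbrakk>g \<in> carrier G; h \<in> carrier G; v \<in> two_part\<rbrakk> \<Longrightarrow> act (g \<otimes> h) v = act g (act h v)"
  by (simp add: act_def word_simps)

lemma act_one [simp]: "v \<in> two_part \<Longrightarrow> act \<one> v = v" "g \<in> carrier G \<Longrightarrow> act g \<one> = \<one>"
  by (simp_all add: act_def)

lemma act_inv [simp]:
  "\<lbrakk>g \<in> carrier G; v \<in> two_part\<rbrakk> \<Longrightarrow> act (inv g) (act g v) = v"
  "\<lbrakk>g \<in> carrier G; v \<in> two_part\<rbrakk> \<Longrightarrow> act g (act (inv g) v) = v"
  by (simp_all flip: act_comp)

lemma act_two_part: "\<lbrakk>g \<in> two_part; v \<in> two_part\<rbrakk> \<Longrightarrow> act g v = v"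
  unfolding act_def
  by (rule iffD2[OF conj_eq_iff]) (rule N.mem_carrier two_part_commute, assumption+)+

text \<open>
  An element outside \<open>two_part\<close> centralizes no involution, by \<open>cent_square\<close>.
\<close>

lemma act_free:
  assumes "g \<in> carrier G" "v \<in> two_part" "v \<noteq> \<one>" "act g v = v"
  shows "g \<in> two_part"
proof -
  have "v \<otimes> g = g \<otimes> v"
    using assms(4)[unfolded act_def conj_eq_iff[OF assms(1) N.mem_carrier[OF assms(2)] N.mem_carrier[OF assms(2)]], symmetric] .
  with assms(1) have "g \<in> cent v" unfolding cent_def by (intro CollectI conjI)
  moreover have "v \<in> involutions" using assms(2,3) unfolding two_part_eq by blast
  ultimately have "g \<otimes> g = \<one>" using cent_square[of v g] by simp
  thus ?thesis using assms(1) by (intro two_partI)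
qed

lemma act_eq_imp:
  assumes "g \<in> carrier G" "h \<in> carrier G" "v \<in> two_part" "v \<noteq> \<one>" "act g v = act h v"
  shows "inv h \<otimes> g \<in> two_part"
  by (rule act_free[of _ v]) (use assms in \<open>simp_all add: act_comp\<close>)

lemma two_part_normal: "\<lbrakk>g \<in> carrier G; v \<in> two_part\<rbrakk> \<Longrightarrow> g \<otimes> v \<otimes> inv g \<in> two_part"
  unfolding act_def[symmetric] by (rule act_in)

end

locale order_three_pair = commuting_involutions +
  fixes a b
  assumes a: "a \<in> carrier G" "a \<otimes> (a \<otimes> a) = \<one>" "a \<notin> two_part"
    and b: "b \<in> carrier G" "b \<otimes> (b \<otimes> b) = \<one>" "b \<notin> two_part"
begin

text \<open>
  Written additively: \<open>x\<^sup>2 + x + 1 = 0\<close> on \<open>two_part\<close>, since \<open>v + x v + x\<^sup>2 v\<close> is fixed by \<open>x\<close>.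
\<close>

lemma act_square_of_order_three:
  assumes x: "x \<in> carrier G" "x \<otimes> (x \<otimes> x) = \<one>" "x \<notin> two_part" and v: "v \<in> two_part"
  shows "act x (act x v) = act x v \<otimes> v"
proof -
  define p where "p = v \<otimes> (act x v \<otimes> act x (act x v))"
  have p: "p \<in> two_part" using x v by (simp add: p_def)
  have "act (x \<otimes> (x \<otimes> x)) v = act x (act x (act x v))" using x(1) v by (simp add: act_comp)
  hence "act x (act x (act x v)) = v" using x(2) v by simp
  hence "act x p = p" using x(1) v by (simp add: p_def act_mult two_part_simps)
  hence "p = \<one>" using act_free[OF x(1) p] x(3) by blast
  hence "v \<otimes> act x v = act x (act x v)"
    using two_part_cancel[of "v \<otimes> act x v" "act x (act x v)"] x(1) v by (simp add: p_def two_part_assoc)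
  thus ?thesis using x(1) v by (simp add: two_part_simps)
qed

lemmas act_aa = act_square_of_order_three[OF a]
  and act_bb = act_square_of_order_three[OF b]

lemma inv_a: "inv a = a \<otimes> a" and inv_b: "inv b = b \<otimes> b"
  using a b by (auto intro!: inv_equality simp: m_assoc)

lemma act_inv_a: "v \<in> two_part \<Longrightarrow> act (inv a) v = act a v \<otimes> v"
  and act_inv_b: "v \<in> two_part \<Longrightarrow> act (inv b) v = act b v \<otimes> v"
  using a(1) b(1) by (simp_all add: inv_a inv_b act_comp act_aa act_bb)

lemmas expand = act_comp act_inv_a act_inv_b act_mult act_aa act_bb inv_mult_group two_part_simps

text \<open>
  From here on \<open>two_part\<close> is viewed as a vector space over the field with two elements, and group
  elements as linear operators. The operator \<open>u\<close> is \<open>a b + b a\<close>.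
\<close>

definition u where "u v = act a (act b v) \<otimes> act b (act a v)"

lemma u_in [simp]: "v \<in> two_part \<Longrightarrow> u v \<in> two_part"
  using a b by (simp add: u_def)

lemma u_mult: "\<lbrakk>v \<in> two_part; w \<in> two_part\<rbrakk> \<Longrightarrow> u (v \<otimes> w) = u v \<otimes> u w"
  using a(1) b(1) by (simp add: u_def act_mult two_part_simps)

lemma u_a: "v \<in> two_part \<Longrightarrow> u (act a v) = act (inv a) (u v)"
  and u_b: "v \<in> two_part \<Longrightarrow> u (act b v) = act (inv b) (u v)"
  using a(1) b(1) by (simp_all add: u_def expand)

lemma u_inv:
  assumes x: "x \<in> carrier G" "\<And>v. v \<in> two_part \<Longrightarrow> u (act x v) = act (inv x) (u v)"
    and v: "v \<in> two_part"
  shows "u (act (inv x) v) = act x (u v)"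
proof -
  have "act x (u v) = act x (u (act x (act (inv x) v)))" using x(1) v by simp
  also have "\<dots> = act x (act (inv x) (u (act (inv x) v)))"
    using x(2)[of "act (inv x) v"] x(1) v by simp
  also have "\<dots> = u (act (inv x) v)" using x(1) v by simp
  finally show ?thesis by (rule sym)
qed

lemmas u_inv_a = u_inv[OF a(1) u_a] and u_inv_b = u_inv[OF b(1) u_b]

lemma u_pow:
  assumes "x \<in> carrier G" "\<And>v. v \<in> two_part \<Longrightarrow> u (act x v) = act (inv x) (u v)" "v \<in> two_part"
  shows "u (act (x [^] (k::nat)) v) = act (inv (x [^] k)) (u v)"
  using assms(3)
proof (induction k arbitrary: v)
  case (Suc k)
  have "u (act (x [^] Suc k) v) = act (inv (x [^] k)) (act (inv x) (u v))"
    using assms(1,2) Suc by (simp add: act_comp)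
  also have "\<dots> = act (inv (x [^] k) \<otimes> inv x) (u v)" using assms(1) Suc by (simp add: act_comp)
  also have "inv (x [^] k) \<otimes> inv x = inv (x \<otimes> x [^] k)" using assms(1) by (simp add: inv_mult_group)
  also have "x \<otimes> x [^] k = x [^] Suc k" using assms(1) by (metis nat_pow_Suc2)
  finally show ?case .
qed (use assms in simp)

text \<open>
  Operators commuting with the action of the group generated by \<open>a\<close> and \<open>b\<close>.
\<close>

definition central where
  "central f \<longleftrightarrow> (\<forall>v\<in>two_part. f v \<in> two_part \<and> (\<forall>k\<in>generate G {a, b}. f (act k v) = act k (f v)))"

lemma K_carrier: "k \<in> generate G {a, b} \<Longrightarrow> k \<in> carrier G"
  using generate_in_carrier[of "{a, b}"] a b by auto

lemma centralI:
  assumes "\<And>v. v \<in> two_part \<Longrightarrow> f v \<in> two_part"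
    "\<And>v. v \<in> two_part \<Longrightarrow> f (act a v) = act a (f v)"
    "\<And>v. v \<in> two_part \<Longrightarrow> f (act b v) = act b (f v)"
  shows "central f"
  unfolding central_def
proof safe
  fix v k assume v: "v \<in> two_part" and "k \<in> generate G {a, b}"
  from this(2,1) show "f (act k v) = act k (f v)"
  proof (induction arbitrary: v)
    case one
    thus ?case using assms by simp
  next
    case (incl h)
    thus ?case using assms by auto
  next
    case (inv h)
    have h: "h \<in> carrier G" using inv.hyps a(1) b(1) by blast
    have "f (act h (act (inv h) v)) = act h (f (act (inv h) v))"
      using inv.hyps assms(2,3)[OF act_in[OF inv_closed[OF h] inv.prems]] by blast
    hence "act (inv h) (f v) = act (inv h) (act h (f (act (inv h) v)))" using h inv.prems by simp
    thus ?case using h inv.prems assms(1)[of "act (inv h) v"] by simp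
  next
    case (eng h k)
    have "h \<in> carrier G" "k \<in> carrier G" using eng.hyps K_carrier by auto
    thus ?case using eng.IH eng.prems assms(1) by (simp add: act_comp)
  qed
qed (use assms in auto)

lemma central_mult: "\<lbrakk>central f; central g\<rbrakk> \<Longrightarrow> central (\<lambda>v. f v \<otimes> g v)"
  by (auto simp: central_def act_mult K_carrier)

lemma central_comp: "\<lbrakk>central f; central g\<rbrakk> \<Longrightarrow> central (\<lambda>v. f (g v))"
  by (auto simp: central_def K_carrier)

lemma central_cong: "\<lbrakk>central f; \<And>v. v \<in> two_part \<Longrightarrow> g v = f v\<rbrakk> \<Longrightarrow> central g"
  by (auto simp: central_def K_carrier)

text \<open>
  This is \<open>a b\<^sup>-\<^sup>1 + b a\<^sup>-\<^sup>1\<close>, the trace of \<open>a b\<^sup>-\<^sup>1\<close>, rewritten with the quadratic equations for \<open>a\<close> and \<open>b\<close>.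
\<close>

definition z where "z v = u v \<otimes> (act a v \<otimes> act b v)"

lemma central_z: "central z"
  using a(1) b(1) by (intro centralI) (simp_all add: z_def u_def expand)

text \<open>
  The algebra generated by \<open>a\<close> and \<open>b\<close> has an involutive antiautomorphism that agrees with inversion
  on the group that they generate. So this is the reduced trace of \<open>x\<close> in a quaternion algebra,
  which explains why it is central.
\<close>

definition trace where "trace x v = act x v \<otimes> act (inv x) v"

lemma z_trace:
  assumes "x \<in> generate G {a, b}" "v \<in> two_part"
  shows "z (trace x v) = z (act x v) \<otimes> act (inv x) (z v)"
proof -
  have "inv x \<in> generate G {a, b}"
    using assms generate_m_inv_closed[of "{a, b}"] a b by auto
  hence "z (act (inv x) v) = act (inv x) (z v)" using central_z assms by (auto simp: central_def)
  thus ?thesis using assms K_carrier[OF assms(1)] a(1) b(1)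
    by (simp add: trace_def z_def[of "act x v \<otimes> act (inv x) v"] z_def[of "act x v"]
        z_def[of "act (inv x) v", symmetric] u_mult act_mult two_part_simps)
      (simp add: z_def two_part_simps)
qed

text \<open>
  The four traces of \<open>y x\<close>, for \<open>y\<close> in the basis \<open>1, a, b, ab\<close> of the algebra over its center.
  Together they are stable under left multiplication of \<open>x\<close> by \<open>a\<close> and \<open>b\<close>.
\<close>

definition traces_central where
  "traces_central x \<longleftrightarrow> x \<in> generate G {a, b} \<and> central (trace x) \<and> central (trace (a \<otimes> x)) \<and> central (trace (b \<otimes> x))
     \<and> central (trace (a \<otimes> b \<otimes> x))"

lemma K_ab: "a \<in> generate G {a, b}" "b \<in> generate G {a, b}"
  by (auto intro: generate.incl)

lemma trace_one: "v \<in> two_part \<Longrightarrow> trace \<one> v = \<one>"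
  by (simp add: trace_def two_part_square)

lemma traces_central_one: "traces_central \<one>"
proof -
  have "central (\<lambda>v. v)" "central (\<lambda>v. \<one>)" by (auto simp: central_def K_carrier)
  moreover have "central (trace a)" "central (trace b)"
    by (rule central_cong[OF \<open>central (\<lambda>v. v)\<close>]; use a(1) b(1) in \<open>simp add: trace_def expand\<close>)+
  moreover have "central (trace \<one>)"
    by (rule central_cong[OF \<open>central (\<lambda>v. \<one>)\<close>]) (rule trace_one)
  moreover have "central (trace (a \<otimes> b))"
    by (rule central_cong[OF central_mult[OF central_z \<open>central (\<lambda>v. v)\<close>]])
      (use a(1) b(1) in \<open>simp add: trace_def expand z_def u_def\<close>)
  ultimately show ?thesis using a(1) b(1) by (simp add: traces_central_def generate.one)
qed

lemma trace_aax: "\<lbrakk>x \<in> carrier G; v \<in> two_part\<rbrakk> \<Longrightarrow> trace (a \<otimes> (a \<otimes> x)) v = trace (a \<otimes> x) v \<otimes> trace x v"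
  using a(1) by (simp add: trace_def expand)

lemma trace_bbx: "\<lbrakk>x \<in> carrier G; v \<in> two_part\<rbrakk> \<Longrightarrow> trace (b \<otimes> (b \<otimes> x)) v = trace (b \<otimes> x) v \<otimes> trace x v"
  using b(1) by (simp add: trace_def expand)

lemma trace_abbx: "\<lbrakk>x \<in> carrier G; v \<in> two_part\<rbrakk> \<Longrightarrow> trace (a \<otimes> b \<otimes> (b \<otimes> x)) v = trace (a \<otimes> b \<otimes> x) v \<otimes> trace (a \<otimes> x) v"
  using a(1) b(1) by (simp add: trace_def expand)

text \<open>
  The identity \<open>b a = a b + a + b + z\<close> with central \<open>z\<close>, applied under the trace.
\<close>

lemma trace_bax:
  assumes "x \<in> generate G {a, b}" "v \<in> two_part"
  shows "trace (b \<otimes> (a \<otimes> x)) v = trace (a \<otimes> b \<otimes> x) v \<otimes> (trace (a \<otimes> x) v \<otimes> (trace (b \<otimes> x) v \<otimes> z (trace x v)))"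
  using K_carrier[OF assms(1)] assms(2) a(1) b(1)
  unfolding z_trace[OF assms] by (simp add: trace_def expand z_def u_def)

text \<open>
  From \<open>a b a = a + b + 1 + z a\<close> with central \<open>z\<close>.
\<close>

lemma trace_abax:
  assumes "x \<in> generate G {a, b}" "v \<in> two_part"
  shows "trace (a \<otimes> b \<otimes> (a \<otimes> x)) v = trace (a \<otimes> x) v \<otimes> (trace (b \<otimes> x) v \<otimes> (trace x v \<otimes> z (trace (a \<otimes> x) v)))"
  using K_carrier[OF assms(1)] assms(2) a(1) b(1)
  unfolding z_trace[OF generate.eng[OF K_ab(1) assms(1)] assms(2)]
  by (simp add: trace_def expand z_def u_def)

lemma traces_central_a:
  assumes "traces_central x" shows "traces_central (a \<otimes> x)"
proof -
  have x: "x \<in> generate G {a, b}" and c: "central (trace x)" "central (trace (a \<otimes> x))" "central (trace (b \<otimes> x))"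
     "central (trace (a \<otimes> b \<otimes> x))" using assms by (auto simp: traces_central_def)
  have "central (trace (a \<otimes> (a \<otimes> x)))"
    by (rule central_cong[OF central_mult[OF c(2,1)]]) (simp add: trace_aax K_carrier[OF x])
  moreover have "central (trace (b \<otimes> (a \<otimes> x)))"
    by (rule central_cong[OF central_mult[OF c(4) central_mult[OF c(2) central_mult[OF c(3) central_comp[OF central_z c(1)]]]]])
      (rule trace_bax[OF x])
  moreover have "central (trace (a \<otimes> b \<otimes> (a \<otimes> x)))"
    by (rule central_cong[OF central_mult[OF c(2) central_mult[OF c(3) central_mult[OF c(1) central_comp[OF central_z c(2)]]]]])
      (rule trace_abax[OF x])
  ultimately show ?thesis using c generate.eng[OF K_ab(1) x] by (simp add: traces_central_def)
qed

lemma traces_central_b: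
  assumes "traces_central x" shows "traces_central (b \<otimes> x)"
proof -
  have x: "x \<in> generate G {a, b}" and c: "central (trace x)" "central (trace (a \<otimes> x))" "central (trace (b \<otimes> x))"
     "central (trace (a \<otimes> b \<otimes> x))" using assms by (auto simp: traces_central_def)
  have "central (trace (b \<otimes> (b \<otimes> x)))"
    by (rule central_cong[OF central_mult[OF c(3,1)]]) (simp add: trace_bbx K_carrier[OF x])
  moreover have "central (trace (a \<otimes> b \<otimes> (b \<otimes> x)))"
    by (rule central_cong[OF central_mult[OF c(4,2)]]) (simp add: trace_abbx K_carrier[OF x])
  moreover have "central (trace (a \<otimes> (b \<otimes> x)))"
    using c(4) a(1) b(1) K_carrier[OF x] by (simp add: m_assoc)
  ultimately show ?thesis using c generate.eng[OF K_ab(2) x] by (simp add: traces_central_def)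
qed

lemma traces_central_mult: "\<lbrakk>x \<in> generate G {a, b}; traces_central y\<rbrakk> \<Longrightarrow> traces_central (x \<otimes> y)"
proof (induction arbitrary: y rule: generate.induct)
  case one
  thus ?case using K_carrier by (simp add: traces_central_def)
next
  case (incl h)
  thus ?case using traces_central_a traces_central_b by auto
next
  case (inv h)
  have y: "y \<in> carrier G" using inv K_carrier by (simp add: traces_central_def)
  have "inv h \<otimes> y = h \<otimes> (h \<otimes> y)" using inv.hyps y a(1) b(1) by (auto simp: inv_a inv_b m_assoc)
  thus ?case using inv traces_central_a traces_central_b by auto
next
  case (eng h k)
  have "h \<in> carrier G" "k \<in> carrier G" "y \<in> carrier G"
    using eng.hyps eng.prems K_carrier by (auto simp: traces_central_def)
  thus ?case using eng.IH eng.prems by (simp add: m_assoc)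
qed

lemma central_trace: "x \<in> generate G {a, b} \<Longrightarrow> central (trace x)"
  using traces_central_mult[OF _ traces_central_one, of x] K_carrier[of x] by (simp add: traces_central_def)

lemma exists_nontrivial: obtains v where "v \<in> two_part" "v \<noteq> \<one>"
proof -
  obtain t where "t \<in> involutions" using nonempty by blast
  thus thesis using that[of t] involution_not_odd[of t 1] unfolding two_part_eq involutions_def by blast
qed

lemma conj_mem_two_part:
  assumes "x \<in> carrier G" "y \<in> carrier G" "x \<otimes> y \<in> two_part"
  shows "y \<otimes> x \<in> two_part"
  using two_part_normal[of y "x \<otimes> y"] assms by (simp add: m_assoc)

text \<open>
  If \<open>u\<close> vanishes on a nonzero vector, then \<open>a\<close> and \<open>b\<close> commute on this vector, hence modulo
  \<open>two_part\<close> and on all of \<open>two_part\<close>. Then \<open>(a + b)(a + b\<^sup>-\<^sup>1) = 0\<close>, so that one of the factors has a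
  kernel, and freeness of the action gives the claim.
\<close>

lemma u_eq_one_imp:
  assumes v: "v \<in> two_part" "v \<noteq> \<one>" "u v = \<one>"
  shows "inv a \<otimes> b \<in> two_part \<or> a \<otimes> b \<in> two_part"
proof (rule ccontr)
  assume contra: "\<not> ?thesis"
  have "act (a \<otimes> b) v = act (b \<otimes> a) v"
    using two_part_cancel[of "act (a \<otimes> b) v" "act (b \<otimes> a) v"] v a(1) b(1) by (simp add: u_def act_comp)
  hence h: "inv (b \<otimes> a) \<otimes> (a \<otimes> b) \<in> two_part" using act_eq_imp[of "a \<otimes> b" "b \<otimes> a" v] v a(1) b(1) by simp
  have com: "act a (act b y) = act b (act a y)" if y: "y \<in> two_part" for y
  proof -
    have "act (a \<otimes> b) y = act ((b \<otimes> a) \<otimes> (inv (b \<otimes> a) \<otimes> (a \<otimes> b))) y"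
      using a(1) b(1) by (simp add: r_inv_cancel)
    also have "\<dots> = act (b \<otimes> a) y" using act_two_part[OF h y] h a(1) b(1) y by (subst act_comp) simp_all
    finally show ?thesis using a(1) b(1) y by (simp add: act_comp)
  qed
  define w where "w = act a v \<otimes> act (inv b) v"
  have w: "w \<in> two_part" using a(1) b(1) v by (simp add: w_def)
  have "act a w \<otimes> act b w = \<one>" using a(1) b(1) v(1) by (simp add: w_def expand com)
  hence eq: "act a w = act b w" using two_part_cancel[of "act a w" "act b w"] w a(1) b(1) by simp
  have "w = \<one>"
  proof (rule ccontr)
    assume "w \<noteq> \<one>"
    hence "inv a \<otimes> b \<in> two_part" using act_eq_imp[OF b(1) a(1) w] eq by simp
    thus False using contra by simp
  qed
  hence "act a v = act (inv b) v" using two_part_cancel[of "act a v" "act (inv b) v"] v(1) a(1) b(1) by (simp add: w_def)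
  hence "inv (inv b) \<otimes> a \<in> two_part" using act_eq_imp[OF a(1) inv_closed[OF b(1)] v(1,2)] by simp
  hence "a \<otimes> b \<in> two_part" using conj_mem_two_part[of b a] a(1) b(1) by simp
  thus False using contra by simp
qed

text \<open>
  Two elements of order three generate the same subgroup modulo \<open>two_part\<close>. Otherwise \<open>u\<close> is
  injective. Let \<open>w = (a b)\<^sup>-\<^sup>1 a\<^sup>-\<^sup>1 b\<^sup>-\<^sup>1\<close>, the quotient of \<open>a b\<close> and its image under the automorphism induced
  by \<open>u\<close>. It is inverted by this automorphism, and so is its square root \<open>r\<close>;
  therefore \<open>f = a b r\<close> commutes with \<open>u\<close>. Now \<open>u trace(f)\<close> is the trace of \<open>u f\<close>, hence central like
  \<open>trace(f)\<close>. As \<open>u\<close> does not commute with \<open>a\<close> this forces \<open>trace(f) = 0\<close>, that is, \<open>f\<^sup>2 = 1\<close>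
  and \<open>f = 1\<close> on \<open>two_part\<close>. So \<open>a b = r\<^sup>-\<^sup>1\<close> is inverted by \<open>u\<close>, which makes \<open>a\<close> and
  \<open>b\<close> commute on some nonzero vector, against the injectivity of \<open>u\<close>.
\<close>

theorem order_three_unique: "inv a \<otimes> b \<in> two_part \<or> a \<otimes> b \<in> two_part"
proof (rule ccontr)
  assume contra: "\<not> ?thesis"
  have u_inj: "v = \<one>" if "v \<in> two_part" "u v = \<one>" for v
    using u_eq_one_imp[of v] that contra by blast
  define w where "w = inv b \<otimes> a \<otimes> inv b"
  have wc: "w \<in> carrier G" using a(1) b(1) by (simp add: w_def)
  have "w \<notin> two_part"
  proof
    assume "w \<in> two_part"
    hence "b \<otimes> w \<otimes> inv b \<in> two_part" using two_part_normal b(1) by blast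
    also have "b \<otimes> w \<otimes> inv b = a \<otimes> (inv b \<otimes> inv b)" using a(1) b(1) by (simp add: w_def word_simps)
    also have "inv b \<otimes> inv b = b" unfolding inv_b using b(1,2) by (simp add: m_assoc)
    finally show False using contra by simp
  qed
  then obtain m :: nat where "odd m" "w [^] m = \<one>" using dichotomy[OF wc] wc by (auto intro: two_partI)
  then obtain k :: nat where k: "w [^] k \<otimes> w [^] k = w" using odd_square_root[OF wc] by metis
  define r where "r = w [^] k"
  have r: "r \<in> carrier G" "r \<otimes> r = w" using wc k by (simp_all add: r_def)
  define f where "f = a \<otimes> b \<otimes> r"
  have fc: "f \<in> carrier G" using a(1) b(1) r by (simp add: f_def)
  have wK: "w \<in> generate G {a, b}"
    unfolding w_def using K_ab by (auto intro!: generate.eng generate.inv)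
  have rK: "r \<in> generate G {a, b}"
    unfolding r_def
  proof (induction k)
    case 0
    show ?case by (simp add: generate.one)
  next
    case (Suc k)
    show ?case using generate.eng[OF Suc wK] by simp
  qed
  have fK: "f \<in> generate G {a, b}" unfolding f_def using K_ab rK by (intro generate.eng)
  have u_w: "u (act w v) = act (inv w) (u v)" if v: "v \<in> two_part" for v
    using a(1) b(1) v by (simp add: w_def act_comp inv_mult_group u_inv_b u_a del: act_inv)
  have u_r: "u (act r v) = act (inv r) (u v)" if v: "v \<in> two_part" for v
    unfolding r_def by (rule u_pow[OF wc u_w v])
  have f_eq: "inv a \<otimes> inv b \<otimes> inv r = f"
  proof -
    have "inv a \<otimes> inv b = a \<otimes> b \<otimes> w"
      using a(1) b(1) by (simp add: w_def word_simps inv_a)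
    also have "\<dots> = f \<otimes> r" unfolding r(2)[symmetric] f_def using a(1) b(1) r(1) by (simp add: m_assoc)
    finally show ?thesis using fc r(1) by (simp add: m_assoc)
  qed
  have u_f: "u (act f v) = act f (u v)" if v: "v \<in> two_part" for v
  proof -
    have "u (act f v) = act (inv a) (act (inv b) (act (inv r) (u v)))"
      using a(1) b(1) r(1) v by (simp add: f_def act_comp u_a u_b u_r)
    also have "\<dots> = act (inv a \<otimes> inv b \<otimes> inv r) (u v)"
      using a(1) b(1) r(1) v by (simp add: act_comp)
    finally show ?thesis by (simp only: f_eq)
  qed
  have u_trace: "u (trace f v) = trace (a \<otimes> b \<otimes> f) v \<otimes> trace (b \<otimes> a \<otimes> f) v" if v: "v \<in> two_part" for v
  proof -
    have "u (act (inv f) v) = act (inv f) (u v)"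
    proof -
      have "act (inv f) (u v) = act (inv f) (u (act f (act (inv f) v)))" using fc v by simp
      also have "\<dots> = u (act (inv f) v)" using u_f[of "act (inv f) v"] fc v by simp
      finally show ?thesis by simp
    qed
    hence "u (trace f v) = u (act f v) \<otimes> act (inv f) (u v)" using fc v by (simp add: trace_def u_mult)
    thus ?thesis using fc v a(1) b(1) by (simp add: trace_def u_def expand)
  qed
  have trace_in: "trace f v \<in> two_part" if "v \<in> two_part" for v
    using fc that by (simp add: trace_def)
  have "trace f v = \<one>" if v: "v \<in> two_part" for v
  proof -
    have c: "central (\<lambda>v. trace (a \<otimes> b \<otimes> f) v \<otimes> trace (b \<otimes> a \<otimes> f) v)" "central (trace f)"
      using K_ab fK by (simp_all add: central_mult central_trace generate.eng)
    have av: "act a v \<in> two_part" using a(1) v by simp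
    have "act (inv a) (u (trace f v)) = u (act a (trace f v))" using u_a[OF trace_in[OF v]] by simp
    also have "\<dots> = u (trace f (act a v))" using c(2) v K_ab(1) by (simp add: central_def)
    also have "\<dots> = act a (u (trace f v))"
      using c(1) v K_ab(1) unfolding u_trace[OF v] u_trace[OF av] central_def by blast
    finally have "act a (u (trace f v)) \<otimes> u (trace f v) = act a (u (trace f v))" using trace_in[OF v] by (simp add: act_inv_a)
    moreover have "u (trace f v) \<in> carrier G" "act a (u (trace f v)) \<in> carrier G"
      using a(1) trace_in[OF v] by simp_all
    ultimately have "u (trace f v) = \<one>" using l_cancel_one by blast
    thus ?thesis using u_inj trace_in[OF v] by blast
  qed
  hence "act f v = act (inv f) v" if "v \<in> two_part" for v
    using that fc two_part_cancel[of "act f v" "act (inv f) v"] by (simp add: trace_def)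
  moreover obtain v where v: "v \<in> two_part" "v \<noteq> \<one>" by (rule exists_nontrivial)
  ultimately have "inv (inv f) \<otimes> f \<in> two_part" using act_eq_imp[OF fc inv_closed[OF fc] v] by simp
  hence "f \<otimes> f \<in> two_part" using fc by simp
  hence "(f \<otimes> f) \<otimes> (f \<otimes> f) = \<one>" by (rule two_part_square)
  hence fN: "f \<in> two_part" using square_one_if_fourth_power[OF fc] two_partI[OF fc] by simp
  define y where "y = act (inv a) (act (inv b) (u v))"
  have uv: "u v \<in> two_part" "u v \<noteq> \<one>" using u_inj[OF v(1)] v by auto
  have y: "y \<in> two_part" using a(1) b(1) v by (simp add: y_def)
  have "u (act (a \<otimes> b) v) = y" using a(1) b(1) v by (simp add: act_comp u_a u_b y_def)
  also have "act (a \<otimes> b) v = act (inv r) v"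
  proof -
    have "act (a \<otimes> b) v = act f (act (inv r) v)"
      using a(1) b(1) r(1) v by (simp add: f_def act_comp)
    also have "\<dots> = act (inv r) v" using fN r(1) v by (simp add: act_two_part)
    finally show ?thesis .
  qed
  also have "u (act (inv r) v) = act r (u v)" using u_inv[OF r(1) u_r] v by simp
  finally have "act r (u v) = y" .
  hence "act a (act b y) = act a (act b (act r (u v)))" by simp
  also have "\<dots> = act f (u v)" using a(1) b(1) r(1) v by (simp add: f_def act_comp)
  also have "\<dots> = u v" using fN uv by (simp add: act_two_part)
  finally have ab: "act a (act b y) = u v" .
  also have "\<dots> = act b (act a y)" using a(1) b(1) uv by (simp add: y_def)
  finally have "u y = \<one>" using a(1) b(1) y by (simp add: u_def two_part_square)
  hence "y = \<one>" using u_inj y by blast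
  hence "act a (act b y) = \<one>" using a(1) b(1) by simp
  thus False using uv ab by simp
qed

end

section \<open>Groups with a single subgroup of order three\<close>

locale unique_order_three = group +
  fixes \<alpha>
  assumes odd_prime_power: "h \<in> carrier G \<Longrightarrow> \<exists>p k. Factorial_Ring.prime (p::nat) \<and> p \<noteq> 2 \<and> h [^] (p ^ k) = \<one>"
    and exponent_nine: "\<lbrakk>h \<in> carrier G; h [^] ((3::nat) ^ k) = \<one>\<rbrakk> \<Longrightarrow> h [^] (9::nat) = \<one>"
    and \<alpha>: "\<alpha> \<in> carrier G" "\<alpha> \<noteq> \<one>" "\<alpha> [^] (3::nat) = \<one>"
    and unique: "\<lbrakk>h \<in> carrier G; h [^] (3::nat) = \<one>\<rbrakk> \<Longrightarrow> h \<in> {\<one>, \<alpha>, inv \<alpha>}"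
begin

lemma cube: "h \<in> carrier G \<Longrightarrow> h [^] (3::nat) = h \<otimes> (h \<otimes> h)"
  by (simp add: numeral_eq_Suc m_assoc)

text \<open>
  An element that inverts \<open>\<alpha>\<close> has a square that centralizes \<open>\<alpha>\<close>; since its order is odd, it is
  a power of its square and centralizes \<open>\<alpha>\<close> itself.
\<close>

lemma \<alpha>_central:
  assumes g: "g \<in> carrier G"
  shows "g \<otimes> \<alpha> = \<alpha> \<otimes> g"
proof -
  define \<beta> where "\<beta> = g \<otimes> \<alpha> \<otimes> inv g"
  have \<beta>: "\<beta> \<in> carrier G" using g \<alpha> by (simp add: \<beta>_def)
  have "\<beta> \<otimes> (\<beta> \<otimes> \<beta>) = g \<otimes> (\<alpha> \<otimes> (\<alpha> \<otimes> \<alpha>)) \<otimes> inv g"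
    using g \<alpha>(1) by (simp add: \<beta>_def word_simps)
  also have "\<alpha> \<otimes> (\<alpha> \<otimes> \<alpha>) = \<one>" using \<alpha>(3) unfolding cube[OF \<alpha>(1)] .
  also have "g \<otimes> \<one> \<otimes> inv g = \<one>" using g by simp
  finally have "\<beta> \<in> {\<one>, \<alpha>, inv \<alpha>}" using unique[OF \<beta>] cube[OF \<beta>] by simp
  moreover have "\<beta> \<noteq> \<one>" using g \<alpha>(1,2) conj_eq_iff[of g \<alpha> \<one>] by (simp add: \<beta>_def)
  ultimately consider "\<beta> = \<alpha>" | "\<beta> = inv \<alpha>" by blast
  thus ?thesis
  proof cases
    case 1
    thus ?thesis using conj_eq_iff[of g \<alpha> \<alpha>] g \<alpha>(1) by (simp add: \<beta>_def)
  next
    case 2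
    have "g \<otimes> \<alpha> = inv \<alpha> \<otimes> g" using 2 conj_eq_iff[of g \<alpha> "inv \<alpha>"] g \<alpha>(1) by (simp add: \<beta>_def)
    hence ga: "\<alpha> \<otimes> (g \<otimes> \<alpha>) = g" using g \<alpha>(1) by (simp add: r_inv_cancel)
    have "\<alpha> \<otimes> (g \<otimes> g) = \<alpha> \<otimes> (g \<otimes> (\<alpha> \<otimes> (g \<otimes> \<alpha>)))" by (simp only: ga)
    also have "\<dots> = (\<alpha> \<otimes> (g \<otimes> \<alpha>)) \<otimes> (g \<otimes> \<alpha>)" using g \<alpha>(1) by (simp add: m_assoc)
    also have "\<dots> = (g \<otimes> g) \<otimes> \<alpha>" unfolding ga using g \<alpha>(1) by (simp add: m_assoc)
    finally have gg: "\<alpha> \<otimes> (g \<otimes> g) = (g \<otimes> g) \<otimes> \<alpha>" .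
    obtain p k where p: "Factorial_Ring.prime (p::nat)" "p \<noteq> 2" "g [^] (p ^ k) = \<one>" using odd_prime_power[OF g] by blast
    have "odd (p ^ k)" using p(1,2) prime_odd_nat[of p] prime_ge_2_nat[of p] by auto
    then obtain i :: nat where i: "g [^] i \<otimes> g [^] i = g" using odd_square_root[OF g p(3)] by metis
    have "\<alpha> \<otimes> (g \<otimes> g) [^] i = (g \<otimes> g) [^] i \<otimes> \<alpha>" using intertwine_pow[OF \<alpha>(1) _ _ gg] g by simp
    also have "(g \<otimes> g) [^] i = g" using i g by (simp add: pow_mult_distrib)
    finally show ?thesis by simp
  qed
qed

definition Z where "Z = {\<one>, \<alpha>, inv \<alpha>}"

lemma Z_carrier [simp]: "z \<in> Z \<Longrightarrow> z \<in> carrier G"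
  using \<alpha> by (auto simp: Z_def)

lemma Z_comm: "\<lbrakk>z \<in> Z; g \<in> carrier G\<rbrakk> \<Longrightarrow> g \<otimes> z = z \<otimes> g"
proof -
  assume z: "z \<in> Z" and g: "g \<in> carrier G"
  have "inv g \<otimes> \<alpha> = \<alpha> \<otimes> inv g" using \<alpha>_central g by simp
  hence "inv (inv g \<otimes> \<alpha>) = inv (\<alpha> \<otimes> inv g)" by simp
  hence "inv \<alpha> \<otimes> g = g \<otimes> inv \<alpha>" using g \<alpha>(1) by (simp add: inv_mult_group)
  thus "g \<otimes> z = z \<otimes> g" using z g \<alpha>_central[OF g] by (auto simp: Z_def)
qed

lemma Z_iff: "h \<in> Z \<longleftrightarrow> h \<in> carrier G \<and> h [^] (3::nat) = \<one>"
proof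
  assume "h \<in> Z"
  moreover have "inv \<alpha> [^] (3::nat) = \<one>" using \<alpha> by (simp add: nat_pow_inv)
  ultimately show "h \<in> carrier G \<and> h [^] (3::nat) = \<one>" using \<alpha> by (auto simp: Z_def)
qed (use unique in \<open>auto simp: Z_def\<close>)

lemma Z_I: "\<lbrakk>h \<in> carrier G; h \<otimes> (h \<otimes> h) = \<one>\<rbrakk> \<Longrightarrow> h \<in> Z"
  unfolding Z_iff by (simp add: cube)

lemma Z_cube: "h \<in> Z \<Longrightarrow> h \<otimes> (h \<otimes> h) = \<one>"
  unfolding Z_iff using cube[of h] by metis

lemma Z_mult: "\<lbrakk>z \<in> Z; w \<in> Z\<rbrakk> \<Longrightarrow> z \<otimes> w \<in> Z"
  using Z_comm[of z w] pow_mult_distrib[of z w 3] by (simp add: Z_iff)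

lemma Z_inv: "z \<in> Z \<Longrightarrow> inv z \<in> Z"
  by (simp add: Z_iff nat_pow_inv)

text \<open>
  Every \<open>h\<close> commutes with \<open>\<alpha>\<close>, so the prime power condition on \<open>h \<alpha>\<close> makes \<open>h\<close> a \<open>3\<close>-element.
\<close>

lemma pow_nine:
  assumes h: "h \<in> carrier G"
  shows "h [^] (9::nat) = \<one>"
proof (cases "h = \<one>")
  case False
  obtain p k where p: "Factorial_Ring.prime (p::nat)" "h [^] (p ^ k) = \<one>" using odd_prime_power[OF h] by blast
  obtain r l where r: "Factorial_Ring.prime (r::nat)" "(h \<otimes> \<alpha>) [^] (r ^ l) = \<one>"
    using odd_prime_power[of "h \<otimes> \<alpha>"] h \<alpha> by auto
  have "p = 3"
    by (rule commuting_prime_power_same_prime[OF h \<alpha>(1) \<alpha>_central[OF h] False \<alpha>(2) p _ _ r, of _ 1])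
      (use \<alpha> in simp_all)
  thus ?thesis using exponent_nine[OF h] p by simp
qed simp

lemma cube_in_Z: "h \<in> carrier G \<Longrightarrow> h \<otimes> (h \<otimes> h) \<in> Z"
proof -
  assume h: "h \<in> carrier G"
  have "(h [^] (3::nat)) [^] (3::nat) = \<one>" using pow_nine[OF h] h by (simp add: nat_pow_pow)
  thus ?thesis using h by (simp add: Z_iff cube[symmetric])
qed

text \<open>
  The group modulo the central subgroup \<open>Z\<close> has exponent three, and in such a group every element commutes
  with its conjugates. Explicitly, comparing the cubes of \<open>x y\<^sup>-\<^sup>1\<close> and of \<open>y x\<close>, which both
  lie in \<open>Z\<close>, shows that \<open>x\<close> commutes with \<open>x c = y\<^sup>-\<^sup>1 x y\<close> up to a factor \<open>\<delta>\<close> in \<open>Z\<close>. Then \<open>x\<^sup>3\<close> and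
  \<open>(x c)\<^sup>3 = x\<^sup>3 c\<^sup>3\<close> agree, being conjugate and central, so \<open>c\<close> has order dividing three and lies in \<open>Z\<close>. So \<open>x\<close> and \<open>y\<close>
  commute up to \<open>Z\<close>, and \<open>x y\<^sup>-\<^sup>1\<close> has cube \<open>\<one>\<close>.
\<close>

lemma equal_cubes:
  assumes x: "x \<in> carrier G" "x \<otimes> (x \<otimes> x) = \<alpha>" and y: "y \<in> carrier G" "y \<otimes> (y \<otimes> y) = \<alpha>"
  shows "x \<otimes> inv y \<in> Z"
proof -
  define \<zeta> where "\<zeta> = (x \<otimes> inv y) \<otimes> ((x \<otimes> inv y) \<otimes> (x \<otimes> inv y))"
  define \<eta> where "\<eta> = (y \<otimes> x) \<otimes> ((y \<otimes> x) \<otimes> (y \<otimes> x))"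
  have Z: "\<zeta> \<in> Z" "\<eta> \<in> Z" "\<alpha> \<in> Z" unfolding \<zeta>_def \<eta>_def using cube_in_Z x(1) y(1) by (auto simp: Z_def)
  define c where "c = inv x \<otimes> (inv y \<otimes> (x \<otimes> y))"
  have c: "c \<in> carrier G" using x y by (simp add: c_def)
  have xc: "x \<otimes> c = inv y \<otimes> (x \<otimes> y)" using x(1) y(1) by (simp add: c_def r_inv_cancel)
  define W where "W = y \<otimes> (inv x \<otimes> inv y)"
  have W: "W \<in> carrier G" using x y by (simp add: W_def)
  have P: "x \<otimes> (x \<otimes> c) = (\<zeta> \<otimes> \<alpha>) \<otimes> W"
  proof -
    have "x \<otimes> (x \<otimes> c) = \<zeta> \<otimes> (y \<otimes> (inv x \<otimes> (y \<otimes> y)))"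
      unfolding xc \<zeta>_def using x(1) y(1) by (simp add: word_simps)
    also have "y \<otimes> y = \<alpha> \<otimes> inv y"
      using y(1) unfolding y(2)[symmetric] by (simp add: m_assoc)
    also have "inv x \<otimes> (\<alpha> \<otimes> inv y) = \<alpha> \<otimes> (inv x \<otimes> inv y)"
      using \<alpha>_central[of "inv x"] x(1) y(1) \<alpha>(1) by (simp add: m_assoc[symmetric])
    also have "y \<otimes> (\<alpha> \<otimes> (inv x \<otimes> inv y)) = \<alpha> \<otimes> W"
      using \<alpha>_central[of y] x(1) y(1) \<alpha>(1) by (simp add: W_def m_assoc[symmetric])
    finally show ?thesis using Z W by (simp add: m_assoc)
  qed
  have Q: "(x \<otimes> c) \<otimes> x = (\<eta> \<otimes> inv \<alpha>) \<otimes> W"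
  proof -
    have "y \<otimes> (y \<otimes> ((x \<otimes> c) \<otimes> x)) = y \<otimes> (x \<otimes> (y \<otimes> x))"
      unfolding xc using x(1) y(1) by (simp add: word_simps)
    also have "\<dots> = \<eta> \<otimes> (inv x \<otimes> inv y)"
      unfolding \<eta>_def using x(1) y(1) by (simp add: word_simps)
    finally have "y \<otimes> (y \<otimes> (y \<otimes> ((x \<otimes> c) \<otimes> x))) = y \<otimes> (\<eta> \<otimes> (inv x \<otimes> inv y))" by simp
    also have "\<dots> = \<eta> \<otimes> W"
      using Z_comm[OF Z(2) y(1)] x(1) y(1) Z(2) by (simp add: W_def m_assoc[symmetric])
    also have "y \<otimes> (y \<otimes> (y \<otimes> ((x \<otimes> c) \<otimes> x))) = \<alpha> \<otimes> ((x \<otimes> c) \<otimes> x)"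
      using x(1) y(1) c unfolding y(2)[symmetric] by (simp add: m_assoc)
    finally have "inv \<alpha> \<otimes> (\<alpha> \<otimes> ((x \<otimes> c) \<otimes> x)) = inv \<alpha> \<otimes> (\<eta> \<otimes> W)" by simp
    hence "(x \<otimes> c) \<otimes> x = (inv \<alpha> \<otimes> \<eta>) \<otimes> W" using x(1) c \<alpha>(1) W Z by (simp add: l_inv_cancel m_assoc)
    thus ?thesis using Z_comm[OF Z(2), of "inv \<alpha>"] \<alpha>(1) by simp
  qed
  define \<delta> where "\<delta> = (\<zeta> \<otimes> \<alpha>) \<otimes> inv (\<eta> \<otimes> inv \<alpha>)"
  have \<delta>: "\<delta> \<in> Z" unfolding \<delta>_def using Z by (intro Z_mult Z_inv)
  have "x \<otimes> (x \<otimes> c) = \<delta> \<otimes> ((x \<otimes> c) \<otimes> x)"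
    unfolding P Q \<delta>_def using Z W \<alpha>(1) by (simp add: word_simps)
  also have "\<dots> = (\<delta> \<otimes> x) \<otimes> (c \<otimes> x)" using \<delta> x(1) c by (simp add: m_assoc)
  also have "\<dots> = x \<otimes> (\<delta> \<otimes> (c \<otimes> x))"
    using \<delta> x(1) c by (simp add: Z_comm[OF \<delta>, symmetric] m_assoc)
  finally have com: "x \<otimes> c = \<delta> \<otimes> (c \<otimes> x)" using \<delta> x(1) c by simp
  define \<epsilon> where "\<epsilon> = inv \<delta>"
  have \<epsilon>: "\<epsilon> \<in> Z" "\<epsilon> \<in> carrier G" using \<delta> Z_inv by (auto simp: \<epsilon>_def)
  have cx: "c \<otimes> x = \<epsilon> \<otimes> (x \<otimes> c)" unfolding com \<epsilon>_def using \<delta> x(1) c by (simp add: l_inv_cancel)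
  have pull: "g \<otimes> (\<epsilon> \<otimes> h) = \<epsilon> \<otimes> (g \<otimes> h)" if "g \<in> carrier G" "h \<in> carrier G" for g h
    using Z_comm[OF \<epsilon>(1) that(1)] that \<epsilon>(2) by (simp add: m_assoc[symmetric])
  have cxh: "c \<otimes> (x \<otimes> h) = \<epsilon> \<otimes> (x \<otimes> (c \<otimes> h))" if "h \<in> carrier G" for h
    using cx that x(1) c \<epsilon>(2) by (metis m_assoc m_closed)
  have "(x \<otimes> c) \<otimes> ((x \<otimes> c) \<otimes> (x \<otimes> c)) = (\<epsilon> \<otimes> (\<epsilon> \<otimes> \<epsilon>)) \<otimes> ((x \<otimes> (x \<otimes> x)) \<otimes> (c \<otimes> (c \<otimes> c)))"
  proof -
    have "(x \<otimes> c) \<otimes> ((x \<otimes> c) \<otimes> (x \<otimes> c)) = x \<otimes> (c \<otimes> (x \<otimes> (c \<otimes> (x \<otimes> c))))" using x(1) c by (simp add: m_assoc)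
    also have "c \<otimes> (x \<otimes> c) = \<epsilon> \<otimes> (x \<otimes> (c \<otimes> c))" using cxh c by simp
    also have "x \<otimes> (\<epsilon> \<otimes> (x \<otimes> (c \<otimes> c))) = \<epsilon> \<otimes> (x \<otimes> (x \<otimes> (c \<otimes> c)))" using pull x(1) c by simp
    also have "c \<otimes> (\<epsilon> \<otimes> (x \<otimes> (x \<otimes> (c \<otimes> c)))) = \<epsilon> \<otimes> (c \<otimes> (x \<otimes> (x \<otimes> (c \<otimes> c))))"
      using pull x(1) c by simp
    also have "c \<otimes> (x \<otimes> (x \<otimes> (c \<otimes> c))) = \<epsilon> \<otimes> (x \<otimes> (c \<otimes> (x \<otimes> (c \<otimes> c))))" using cxh x(1) c by simp
    also have "c \<otimes> (x \<otimes> (c \<otimes> c)) = \<epsilon> \<otimes> (x \<otimes> (c \<otimes> (c \<otimes> c)))" using cxh c by simp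
    also have "x \<otimes> (\<epsilon> \<otimes> (x \<otimes> (c \<otimes> (c \<otimes> c)))) = \<epsilon> \<otimes> (x \<otimes> (x \<otimes> (c \<otimes> (c \<otimes> c))))" using pull x(1) c by simp
    also have "x \<otimes> (\<epsilon> \<otimes> (\<epsilon> \<otimes> (\<epsilon> \<otimes> (x \<otimes> (x \<otimes> (c \<otimes> (c \<otimes> c))))))) =
        (\<epsilon> \<otimes> (\<epsilon> \<otimes> \<epsilon>)) \<otimes> ((x \<otimes> (x \<otimes> x)) \<otimes> (c \<otimes> (c \<otimes> c)))"
      using pull[of x "\<epsilon> \<otimes> (\<epsilon> \<otimes> (x \<otimes> (x \<otimes> (c \<otimes> (c \<otimes> c)))))"] pull[of x "\<epsilon> \<otimes> (x \<otimes> (x \<otimes> (c \<otimes> (c \<otimes> c))))"]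
       pull[of x "x \<otimes> (x \<otimes> (c \<otimes> (c \<otimes> c)))"] x(1) c \<epsilon>(2) by (simp add: m_assoc)
    finally show ?thesis .
  qed
  also have "\<epsilon> \<otimes> (\<epsilon> \<otimes> \<epsilon>) = \<one>" by (rule Z_cube[OF \<epsilon>(1)])
  also have "x \<otimes> (x \<otimes> x) = \<alpha>" by (rule x(2))
  finally have "(x \<otimes> c) \<otimes> ((x \<otimes> c) \<otimes> (x \<otimes> c)) = \<alpha> \<otimes> (c \<otimes> (c \<otimes> c))" using \<alpha>(1) c by simp
  moreover have "(x \<otimes> c) \<otimes> ((x \<otimes> c) \<otimes> (x \<otimes> c)) = inv y \<otimes> ((x \<otimes> (x \<otimes> x)) \<otimes> y)"
    unfolding xc using x(1) y(1) by (simp add: word_simps)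
  moreover have "inv y \<otimes> (\<alpha> \<otimes> y) = \<alpha>"
    unfolding \<alpha>_central[OF y(1), symmetric] using y(1) \<alpha>(1) by (simp add: l_inv_cancel)
  ultimately have "\<alpha> \<otimes> (c \<otimes> (c \<otimes> c)) = \<alpha>" by (simp add: x(2))
  hence c3: "c \<otimes> (c \<otimes> c) = \<one>" using \<alpha>(1) c by simp
  hence cZ: "c \<in> Z" using Z_I[OF c] by simp
  have pc: "g \<otimes> (c \<otimes> h) = c \<otimes> (g \<otimes> h)" if "g \<in> carrier G" "h \<in> carrier G" for g h
    using Z_comm[OF cZ that(1)] that c by (simp add: m_assoc[symmetric])
  have yx: "inv y \<otimes> (x \<otimes> h) = c \<otimes> (x \<otimes> (inv y \<otimes> h))" if h: "h \<in> carrier G" for h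
  proof -
    have "inv y \<otimes> (x \<otimes> h) = (x \<otimes> c) \<otimes> (inv y \<otimes> h)" unfolding xc using x(1) y(1) h by (simp add: word_simps)
    also have "x \<otimes> c = c \<otimes> x" by (rule Z_comm[OF cZ x(1)])
    finally show ?thesis using x(1) y(1) h c by (simp add: m_assoc)
  qed
  define v where "v = inv y"
  have v: "v \<in> carrier G" using y by (simp add: v_def)
  note vx = yx[folded v_def]
  have "(x \<otimes> v) \<otimes> ((x \<otimes> v) \<otimes> (x \<otimes> v)) = x \<otimes> (v \<otimes> (x \<otimes> (v \<otimes> (x \<otimes> v))))" using x(1) v by (simp add: m_assoc)
  also have "v \<otimes> (x \<otimes> v) = c \<otimes> (x \<otimes> (v \<otimes> v))" using vx v by simp
  also have "x \<otimes> (c \<otimes> (x \<otimes> (v \<otimes> v))) = c \<otimes> (x \<otimes> (x \<otimes> (v \<otimes> v)))" using pc x(1) v by simp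
  also have "v \<otimes> (c \<otimes> (x \<otimes> (x \<otimes> (v \<otimes> v)))) = c \<otimes> (v \<otimes> (x \<otimes> (x \<otimes> (v \<otimes> v))))" using pc x(1) v by simp
  also have "v \<otimes> (x \<otimes> (x \<otimes> (v \<otimes> v))) = c \<otimes> (x \<otimes> (v \<otimes> (x \<otimes> (v \<otimes> v))))" using vx x(1) v by simp
  also have "v \<otimes> (x \<otimes> (v \<otimes> v)) = c \<otimes> (x \<otimes> (v \<otimes> (v \<otimes> v)))" using vx v by simp
  also have "x \<otimes> (c \<otimes> (x \<otimes> (v \<otimes> (v \<otimes> v)))) = c \<otimes> (x \<otimes> (x \<otimes> (v \<otimes> (v \<otimes> v))))" using pc x(1) v by simp
  also have "x \<otimes> (c \<otimes> (c \<otimes> (c \<otimes> (x \<otimes> (x \<otimes> (v \<otimes> (v \<otimes> v))))))) = (c \<otimes> (c \<otimes> c)) \<otimes> ((x \<otimes> (x \<otimes> x)) \<otimes> (v \<otimes> (v \<otimes> v)))"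
    using pc[of x "c \<otimes> (c \<otimes> (x \<otimes> (x \<otimes> (v \<otimes> (v \<otimes> v)))))"] pc[of x "c \<otimes> (x \<otimes> (x \<otimes> (v \<otimes> (v \<otimes> v))))"]
       pc[of x "x \<otimes> (x \<otimes> (v \<otimes> (v \<otimes> v)))"] x(1) c v by (simp add: m_assoc)
  also have "\<dots> = \<alpha> \<otimes> (v \<otimes> (v \<otimes> v))" unfolding c3 x(2) using \<alpha>(1) v by simp
  also have "v \<otimes> (v \<otimes> v) = inv (y \<otimes> (y \<otimes> y))" unfolding v_def using y(1) by (simp add: inv_mult_group m_assoc)
  also have "\<alpha> \<otimes> inv (y \<otimes> (y \<otimes> y)) = \<one>" unfolding y(2) using \<alpha>(1) by simp
  finally have "x \<otimes> v \<in> Z" using x(1) v by (intro Z_I) simp_all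
  thus ?thesis unfolding v_def .
qed

text \<open>
  A cube is \<open>\<one>\<close>, \<open>\<alpha>\<close> or its inverse. So each element lies in \<open>Z\<close>, or it, or its inverse, has the same
  cube \<open>\<alpha>\<close> as a fixed element \<open>x\<close> and lies in the coset \<open>Z x\<close>.
\<close>

theorem finite_carrier: "finite (carrier G)"
proof (cases "\<exists>x\<in>carrier G. x \<otimes> (x \<otimes> x) = \<alpha>")
  case True
  then obtain x where x: "x \<in> carrier G" "x \<otimes> (x \<otimes> x) = \<alpha>" by blast
  have "h \<in> Z \<union> (\<lambda>z. z \<otimes> x) ` Z \<union> (\<lambda>z. inv (z \<otimes> x)) ` Z" if h: "h \<in> carrier G" for h
  proof -
    have "h \<otimes> (h \<otimes> h) \<in> {\<one>, \<alpha>, inv \<alpha>}" using cube_in_Z[OF h] by (simp add: Z_def)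
    then consider "h \<otimes> (h \<otimes> h) = \<one>" | "h \<otimes> (h \<otimes> h) = \<alpha>" | "h \<otimes> (h \<otimes> h) = inv \<alpha>" by blast
    thus ?thesis
    proof cases
      case 1
      thus ?thesis using Z_I[OF h] by blast
    next
      case 2
      have "h = (h \<otimes> inv x) \<otimes> x" using h x(1) by (simp add: m_assoc)
      thus ?thesis using equal_cubes[OF h 2 x] by blast
    next
      case 3
      have "inv h \<otimes> (inv h \<otimes> inv h) = inv (h \<otimes> (h \<otimes> h))" using h by (simp add: inv_mult_group m_assoc)
      also have "\<dots> = \<alpha>" unfolding 3 using \<alpha>(1) by simp
      finally have "inv h \<otimes> inv x \<in> Z" using equal_cubes[OF inv_closed[OF h] _ x] by simp
      moreover have "h = inv ((inv h \<otimes> inv x) \<otimes> x)" using h x(1) by (simp add: m_assoc)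
      ultimately show ?thesis by blast
    qed
  qed
  hence "carrier G \<subseteq> Z \<union> (\<lambda>z. z \<otimes> x) ` Z \<union> (\<lambda>z. inv (z \<otimes> x)) ` Z" by blast
  moreover have "finite Z" by (simp add: Z_def)
  ultimately show ?thesis by (meson finite_UnI finite_imageI finite_subset)
next
  case False
  have "h \<in> Z" if h: "h \<in> carrier G" for h
  proof -
    have "h \<otimes> (h \<otimes> h) \<noteq> inv \<alpha>"
    proof
      assume *: "h \<otimes> (h \<otimes> h) = inv \<alpha>"
      have "inv h \<otimes> (inv h \<otimes> inv h) = inv (h \<otimes> (h \<otimes> h))" using h by (simp add: inv_mult_group m_assoc)
      also have "\<dots> = \<alpha>" unfolding * using \<alpha>(1) by simp
      finally show False using False h by blast
    qed
    hence "h \<otimes> (h \<otimes> h) = \<one>" using cube_in_Z[OF h] False h unfolding Z_def by blast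
    thus ?thesis using h by (intro Z_I)
  qed
  hence "carrier G \<subseteq> Z" by blast
  thus ?thesis by (rule finite_subset) (simp add: Z_def)
qed

end

text \<open>
  The quotient by \<open>two_part\<close> satisfies the hypotheses on a group with a unique subgroup of order three: an
  element outside \<open>two_part\<close> has odd order, and hence the same order as its coset.
\<close>

lemma (in commuting_involutions) finite_generate_if_exponent_nine:
  assumes prime_power: "\<And>x. x \<in> carrier G \<Longrightarrow> \<exists>p k. Factorial_Ring.prime (p::nat) \<and> x [^] (p ^ k) = \<one>"
    and nine: "\<And>x k. \<lbrakk>x \<in> carrier G; x [^] ((3::nat) ^ k) = \<one>\<rbrakk> \<Longrightarrow> x [^] (9::nat) = \<one>"
    and \<alpha>: "\<alpha> \<in> carrier G" "\<alpha> \<noteq> \<one>" "\<alpha> [^] (3::nat) = \<one>"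
    and B: "finite B" "B \<subseteq> carrier G"
  shows "finite (generate G B)"
proof -
  have normal: "two_part \<lhd> G"
    unfolding normal_inv_iff using N.subgroup_axioms two_part_normal by blast
  interpret N: normal two_part G by (rule normal)
  interpret H: group "G Mod two_part" by (rule N.factorgroup_is_group)
  have coset_one: "two_part #> x = two_part \<longleftrightarrow> x \<in> two_part" if "x \<in> carrier G" for x
    using coset_join1[OF _ that N.subgroup_axioms] coset_join2[OF that N.subgroup_axioms] by blast
  have coset_eqI: "two_part #> x = two_part #> y" if "x \<in> carrier G" "y \<in> carrier G" "inv y \<otimes> x \<in> two_part" for x y
  proof -
    have "y \<otimes> (inv y \<otimes> x) \<otimes> inv y \<in> two_part" using two_part_normal that by blast
    also have "y \<otimes> (inv y \<otimes> x) \<otimes> inv y = x \<otimes> inv y" using that(1,2) by (simp add: r_inv_cancel)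
    finally have "two_part #> (x \<otimes> inv y) = two_part" using coset_one that by simp
    thus ?thesis using coset_mult_inv1 that N.subset by blast
  qed
  have odd: "\<exists>m::nat. odd m \<and> x [^] m = \<one>" if "x \<in> carrier G" "x \<notin> two_part" for x
    using dichotomy[OF that(1)] two_partI[OF that(1)] that(2) by blast
  have pow_in: "x [^] n = \<one>" if x: "x \<in> carrier G" "x \<notin> two_part" and n: "x [^] n \<in> two_part" for x and n :: nat
  proof -
    obtain m :: nat where m: "odd m" "x [^] m = \<one>" using odd x by blast
    have "(x [^] n) [^] (2::nat) = \<one>" using two_part_square[OF n] x by (simp add: numeral_eq_Suc)
    moreover have "(x [^] n) [^] m = (x [^] m) [^] n" using x(1) by (simp add: nat_pow_pow mult.commute)
    hence "(x [^] n) [^] m = \<one>" using m by simp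
    ultimately show ?thesis using one_of_coprime_pow[of "x [^] n" 2 m] x(1) m(1) by simp
  qed
  have reps: "\<exists>x\<in>carrier G. h = two_part #> x" if "h \<in> carrier (G Mod two_part)" for h
    using that unfolding carrier_FactGroup by blast
  have \<alpha>N: "\<alpha> \<notin> two_part"
  proof
    assume "\<alpha> \<in> two_part"
    hence "\<alpha> [^] (2::nat) = \<one>" using two_part_square \<alpha>(1) by (simp add: numeral_eq_Suc)
    thus False using one_of_coprime_pow[OF \<alpha>(1,3), of 2] \<alpha>(2) by simp
  qed
  have cube3: "x \<otimes> (x \<otimes> x) = \<one>" if "x \<in> carrier G" "x [^] (3::nat) = \<one>" for x
    using that by (simp add: numeral_eq_Suc m_assoc)
  have "unique_order_three (G Mod two_part) (two_part #> \<alpha>)"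
  proof (intro unique_order_three.intro H.is_group unique_order_three_axioms.intro)
    fix h assume "h \<in> carrier (G Mod two_part)"
    then obtain x where x: "x \<in> carrier G" "h = two_part #> x" using reps by blast
    show "\<exists>p k. Factorial_Ring.prime (p::nat) \<and> p \<noteq> 2 \<and> h [^]\<^bsub>G Mod two_part\<^esub> (p ^ k) = \<one>\<^bsub>G Mod two_part\<^esub>"
    proof (cases "x \<in> two_part")
      case True
      hence "h = two_part" using coset_one[OF x(1)] x(2) by simp
      hence e: "h [^]\<^bsub>G Mod two_part\<^esub> ((3::nat) ^ 0) = \<one>\<^bsub>G Mod two_part\<^esub>" using x N.FactGroup_pow[OF x(1), of 1] by simp
      have "Factorial_Ring.prime (3::nat)" "(3::nat) \<noteq> 2" by simp_all
      thus ?thesis using e by blast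
    next
      case False
      obtain m :: nat where m: "odd m" "x [^] m = \<one>" using odd x(1) False by blast
      obtain p k where p: "Factorial_Ring.prime (p::nat)" "x [^] (p ^ k) = \<one>" using prime_power[OF x(1)] by blast
      have "p \<noteq> 2"
      proof
        assume "p = 2"
        hence "x = \<one>" using one_of_coprime_pow[OF x(1) m(2) p(2)] m(1) by simp
        thus False using False N.one_closed by simp
      qed
      moreover have "h [^]\<^bsub>G Mod two_part\<^esub> (p ^ k) = \<one>\<^bsub>G Mod two_part\<^esub>"
        using coset_one[OF one_closed] by (simp add: x(2) N.FactGroup_pow[OF x(1)] p(2))
      ultimately show ?thesis using p(1) by blast
    qed
    show "h [^]\<^bsub>G Mod two_part\<^esub> (9::nat) = \<one>\<^bsub>G Mod two_part\<^esub>"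
      if "h [^]\<^bsub>G Mod two_part\<^esub> ((3::nat) ^ k) = \<one>\<^bsub>G Mod two_part\<^esub>" for k
    proof -
      have "x [^] ((3::nat) ^ k) \<in> two_part"
        using that coset_one[of "x [^] ((3::nat) ^ k)"] x by (simp add: N.FactGroup_pow)
      hence "x [^] (9::nat) \<in> two_part"
      proof (cases "x \<in> two_part")
        case True
        hence "x [^] (n::nat) \<in> two_part" for n by (induction n) auto
        thus ?thesis by blast
      next
        case False
        thus ?thesis using pow_in[OF x(1) False] \<open>x [^] ((3::nat) ^ k) \<in> two_part\<close> nine[OF x(1)] by auto
      qed
      thus ?thesis using coset_one[of "x [^] (9::nat)"] x by (simp add: N.FactGroup_pow)
    qed
    show "h \<in> {\<one>\<^bsub>G Mod two_part\<^esub>, two_part #> \<alpha>, inv\<^bsub>G Mod two_part\<^esub> (two_part #> \<alpha>)}"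
      if h3: "h [^]\<^bsub>G Mod two_part\<^esub> (3::nat) = \<one>\<^bsub>G Mod two_part\<^esub>"
    proof (cases "x \<in> two_part")
      case True
      thus ?thesis using coset_one[OF x(1)] x(2) by simp
    next
      case False
      have "x [^] (3::nat) \<in> two_part"
        using h3 coset_one[of "x [^] (3::nat)"] x by (simp add: N.FactGroup_pow)
      hence x3: "x [^] (3::nat) = \<one>" using pow_in[OF x(1) False] by blast
      interpret P: order_three_pair G \<alpha> x
        using cube3[OF \<alpha>(1,3)] cube3[OF x(1) x3] \<alpha>(1) \<alpha>N x(1) False by unfold_locales
      from P.order_three_unique show ?thesis
      proof
        assume "inv \<alpha> \<otimes> x \<in> two_part"
        hence "h = two_part #> \<alpha>" using coset_eqI[OF x(1) \<alpha>(1)] x(2) by simp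
        thus ?thesis by simp
      next
        assume "\<alpha> \<otimes> x \<in> two_part"
        hence "h = two_part #> inv \<alpha>" using coset_eqI[OF x(1) inv_closed[OF \<alpha>(1)]] \<alpha>(1) x(2) by simp
        also have "\<dots> = inv\<^bsub>G Mod two_part\<^esub> (two_part #> \<alpha>)"
          using N.inv_FactGroup[of "two_part #> \<alpha>"] N.rcos_inv[OF \<alpha>(1)] \<alpha>(1) unfolding carrier_FactGroup by simp
        finally show ?thesis by simp
      qed
    qed
  next
    show "two_part #> \<alpha> \<in> carrier (G Mod two_part)" using \<alpha>(1) unfolding carrier_FactGroup by blast
    show "two_part #> \<alpha> \<noteq> \<one>\<^bsub>G Mod two_part\<^esub>" using coset_one[OF \<alpha>(1)] \<alpha>N by simp
    show "(two_part #> \<alpha>) [^]\<^bsub>G Mod two_part\<^esub> (3::nat) = \<one>\<^bsub>G Mod two_part\<^esub>"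
      using coset_one[OF one_closed] by (simp add: N.FactGroup_pow[OF \<alpha>(1)] \<alpha>(3))
  qed
  then interpret U: unique_order_three "G Mod two_part" "two_part #> \<alpha>" .
  define \<rho> where "\<rho> C = (SOME x. x \<in> carrier G \<and> C = two_part #> x)" for C
  have \<rho>: "\<rho> C \<in> carrier G" "C = two_part #> \<rho> C" if "C \<in> carrier (G Mod two_part)" for C
    using someI_ex[of "\<lambda>x. x \<in> carrier G \<and> C = two_part #> x"] reps[OF that] unfolding \<rho>_def by blast+
  show ?thesis
  proof (rule finite_generate_if_virtually_abelian_torsion[OF N.subgroup_axioms _ two_part_commute _ _ _ _ B])
    show "g \<otimes> x \<otimes> inv g \<in> two_part" if "x \<in> two_part" "g \<in> carrier G" for x g
      using two_part_normal that by blast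
    show "\<exists>n>0::nat. x [^] n = \<one>" if "x \<in> two_part" for x using torsion[OF N.mem_carrier[OF that]] .
    show "finite (\<rho> ` carrier (G Mod two_part))" using U.finite_carrier by simp
    show "\<rho> ` carrier (G Mod two_part) \<subseteq> carrier G" using \<rho> by blast
    show "\<exists>t\<in>\<rho> ` carrier (G Mod two_part). inv t \<otimes> g \<in> two_part" if g: "g \<in> carrier G" for g
    proof -
      have C: "two_part #> g \<in> carrier (G Mod two_part)" using g unfolding carrier_FactGroup by blast
      define t where "t = \<rho> (two_part #> g)"
      have t: "t \<in> carrier G" "two_part #> g = two_part #> t" using \<rho>[OF C] by (simp_all add: t_def)
      have "two_part #> (g \<otimes> inv t) = two_part" using coset_mult_inv2[OF t(2) g t(1)] N.subset by blast
      hence "g \<otimes> inv t \<in> two_part" using coset_one[of "g \<otimes> inv t"] g t(1) by simp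
      hence "inv t \<otimes> (g \<otimes> inv t) \<otimes> inv (inv t) \<in> two_part" using two_part_normal[OF inv_closed[OF t(1)]] by blast
      hence "inv t \<otimes> g \<in> two_part" using g t(1) by (simp add: m_assoc)
      thus ?thesis using C unfolding t_def by blast
    qed
  qed
qed

section \<open>Local finiteness\<close>

theorem theorem5:
  fixes G :: "('a, 'b) monoid_scheme" and u\<^sub>2 u\<^sub>3 :: nat
  assumes "BCP_group G"
    and "2 \<in> prime_spectrum G" and "3 \<in> prime_spectrum G"
    and "p_order_bound G 2 u\<^sub>2" and "p_order_bound G 3 u\<^sub>3"
    and "u\<^sub>2 = 1" and "u\<^sub>3 \<in> {1, 2}"
  shows "locally_finite_group G"
proof -
  interpret group G using assms(1) by (simp add: BCP_group_def)
  have ord_prime_power: "\<exists>p k. Factorial_Ring.prime p \<and> ord x = p ^ k" if "x \<in> carrier G" for x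
    using assms(1) that by (auto simp: BCP_group_def)
  have bound: "\<exists>n>0. \<forall>x\<in>carrier G. (\<exists>k. x [^]\<^bsub>G\<^esub> (p ^ k) = \<one>\<^bsub>G\<^esub>) \<longrightarrow> x [^]\<^bsub>G\<^esub> (n::nat) = \<one>\<^bsub>G\<^esub>"
    if p: "Factorial_Ring.prime p" for p :: nat
  proof (cases "p \<in> prime_spectrum G")
    case True
    then obtain u where u: "p_order_bound G p u" using assms(1) by (auto simp: BCP_group_def)
    have "x [^]\<^bsub>G\<^esub> (p ^ u) = \<one>\<^bsub>G\<^esub>" if x: "x \<in> carrier G" "x [^]\<^bsub>G\<^esub> (p ^ k) = \<one>\<^bsub>G\<^esub>" for x k
    proof -
      have "ord x dvd p ^ k" using x pow_eq_id by blast
      then obtain j where j: "ord x = p ^ j" using divides_primepow_nat[OF p] by blast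
      hence "p ^ j \<le> p ^ u" using u x(1) by (auto simp: p_order_bound_def p_element_def)
      hence "j \<le> u" using power_le_imp_le_exp prime_gt_1_nat[OF p] by blast
      thus ?thesis using pow_eq_id[OF x(1)] j le_imp_power_dvd by metis
    qed
    thus ?thesis using prime_gt_0_nat[OF p] by (intro exI[of _ "p ^ u"]) auto
  next
    case False
    have "x = \<one>\<^bsub>G\<^esub>" if x: "x \<in> carrier G" "x [^]\<^bsub>G\<^esub> (p ^ k) = \<one>\<^bsub>G\<^esub>" for x k
    proof -
      have "ord x dvd p ^ k" using x pow_eq_id by blast
      then obtain j where j: "ord x = p ^ j" using divides_primepow_nat[OF p] by blast
      have "j = 0"
      proof (rule ccontr)
        assume "j \<noteq> 0"
        hence "p dvd ord x" "ord x \<noteq> 0" using j prime_gt_0_nat[OF p] by (auto intro: dvd_power)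
        thus False using False p x(1) by (auto simp: prime_spectrum_def)
      qed
      thus ?thesis using j ord_eq_1[OF x(1)] by simp
    qed
    thus ?thesis by (intro exI[of _ 1]) auto
  qed
  have dich: "x \<otimes>\<^bsub>G\<^esub> x = \<one>\<^bsub>G\<^esub> \<or> (\<exists>m::nat. odd m \<and> x [^]\<^bsub>G\<^esub> m = \<one>\<^bsub>G\<^esub>)" if x: "x \<in> carrier G" for x
  proof -
    obtain p k where p: "Factorial_Ring.prime p" "ord x = p ^ k" using ord_prime_power[OF x] by blast
    show ?thesis
    proof (cases "p = 2")
      case True
      hence "ord x \<le> 2" using assms(4,6) p x by (auto simp: p_order_bound_def p_element_def)
      hence "ord x \<in> {1, 2}" using p True by (cases "ord x") (auto simp: le_Suc_eq numeral_eq_Suc)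
      hence "ord x dvd 2" by auto
      hence "x [^]\<^bsub>G\<^esub> (2::nat) = \<one>\<^bsub>G\<^esub>" using pow_eq_id[OF x] by blast
      thus ?thesis using x by (simp add: numeral_eq_Suc)
    next
      case False
      hence "odd (ord x)" using p prime_odd_nat[of p] prime_ge_2_nat[of p] by auto
      thus ?thesis using x pow_ord_eq_1 by blast
    qed
  qed
  interpret square_one_or_odd G using dich by unfold_locales
  have prime_power: "\<exists>p k. Factorial_Ring.prime (p::nat) \<and> x [^]\<^bsub>G\<^esub> (p ^ k) = \<one>\<^bsub>G\<^esub>" if "x \<in> carrier G" for x
    using ord_prime_power[OF that] pow_ord_eq_1[OF that] by metis
  have spec: "\<exists>x\<in>carrier G. x \<noteq> \<one>\<^bsub>G\<^esub> \<and> x [^]\<^bsub>G\<^esub> p = \<one>\<^bsub>G\<^esub>" if p: "p \<in> prime_spectrum G" for p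
  proof -
    obtain x where x: "Factorial_Ring.prime p" "x \<in> carrier G" "ord x \<noteq> 0" "p dvd ord x"
      using p by (auto simp: prime_spectrum_def)
    then obtain m where m: "ord x = p * m" by (auto elim: dvdE)
    have "(x [^]\<^bsub>G\<^esub> m) [^]\<^bsub>G\<^esub> p = \<one>\<^bsub>G\<^esub>" using x(2) pow_ord_eq_1[OF x(2)] m by (simp add: nat_pow_pow mult.commute)
    moreover have "x [^]\<^bsub>G\<^esub> m \<noteq> \<one>\<^bsub>G\<^esub>"
    proof
      assume "x [^]\<^bsub>G\<^esub> m = \<one>\<^bsub>G\<^esub>"
      hence "p * m dvd 1 * m" using pow_eq_id[OF x(2)] m by simp
      hence "p dvd 1" using x(3) m by (simp only: dvd_times_right_cancel_iff) simp
      thus False using x(1) by auto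
    qed
    ultimately show ?thesis using x(2) by (intro bexI[of _ "x [^]\<^bsub>G\<^esub> m"]) auto
  qed
  have ne: "involutions \<noteq> {}"
  proof -
    obtain x where "x \<in> carrier G" "x \<noteq> \<one>\<^bsub>G\<^esub>" "x [^]\<^bsub>G\<^esub> (2::nat) = \<one>\<^bsub>G\<^esub>" using spec[OF assms(2)] by blast
    hence "x \<in> involutions" by (simp add: involutions_def numeral_eq_Suc)
    thus ?thesis by blast
  qed
  have "finite (generate G B)" if B: "finite B" "B \<subseteq> carrier G" for B
  proof (cases "\<forall>x\<in>involutions. \<forall>y\<in>involutions. x \<otimes>\<^bsub>G\<^esub> y = y \<otimes>\<^bsub>G\<^esub> x")
    case True
    interpret commuting_involutions G using True ne by unfold_locales blast+
    have nine: "x [^]\<^bsub>G\<^esub> (9::nat) = \<one>\<^bsub>G\<^esub>" if x: "x \<in> carrier G" "x [^]\<^bsub>G\<^esub> ((3::nat) ^ k) = \<one>\<^bsub>G\<^esub>" for x k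
    proof -
      have "ord x dvd 3 ^ k" using x pow_eq_id by blast
      moreover have "Factorial_Ring.prime (3::nat)" by simp
      ultimately obtain j where j: "ord x = 3 ^ j" using divides_primepow_nat by blast
      hence "(3::nat) ^ j \<le> 3 ^ u\<^sub>3" using assms(5) x(1) by (auto simp: p_order_bound_def p_element_def)
      hence "j \<le> u\<^sub>3" by (simp add: power_le_imp_le_exp)
      hence "j \<le> 2" using assms(7) by auto
      hence "ord x dvd 3 ^ 2" using j le_imp_power_dvd by metis
      thus ?thesis using pow_eq_id[OF x(1), of 9] by simp
    qed
    obtain \<alpha> where \<alpha>: "\<alpha> \<in> carrier G" "\<alpha> \<noteq> \<one>\<^bsub>G\<^esub>" "\<alpha> [^]\<^bsub>G\<^esub> (3::nat) = \<one>\<^bsub>G\<^esub>" using spec[OF assms(3)] by blast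
    show ?thesis
      by (rule finite_generate_if_exponent_nine[OF _ _ \<alpha> B]) (use prime_power nine in blast)+
  next
    case False
    then obtain t s where pair: "t \<in> involutions" "s \<in> involutions" "t \<otimes>\<^bsub>G\<^esub> s \<noteq> s \<otimes>\<^bsub>G\<^esub> t" by blast
    interpret noncommuting_involutions G t s
      using pair by unfold_locales (simp_all add: cent_def)
    show ?thesis
    proof (cases "cent t \<subseteq> {\<one>\<^bsub>G\<^esub>, t}")
      case True
      thus ?thesis using finite_generate_if_small_centralizer[OF pair(1) _ B] by blast
    next
      case False
      then obtain v where "v \<in> cent t" "v \<noteq> \<one>\<^bsub>G\<^esub>" "v \<noteq> t" by blast
      moreover have "finite (cent t)" using cent_finite_if_bounded_prime_power prime_power bound by blast
      ultimately have "finite (carrier G)" using finite_carrier_if_finite_cent by blast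
      moreover have "generate G B \<subseteq> carrier G" using generate_in_carrier[OF B(2)] by blast
      ultimately show ?thesis by (rule finite_subset[rotated])
    qed
  qed
  thus ?thesis using is_group by (auto simp: locally_finite_group_def finitely_generated_subgroup_def)
qed

end
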